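(* In the setting described in the context, let $p\ge2$ and assume that, for every $k\in[1,n]$, $$\mathbb E\big[(H_{k,\varepsilon_k}(X_{k-1},\ldots,X_1,\varepsilon_k))^p\big]\le A_k(p)$$ for some constants $A_k(p)$. Then $$\|S_n\|_p\le\sqrt{A(n,p)},$$ where $$A(n,p)=\big(a_{n-1}(n-1)\big)^2\big(A_1(p)\big)^{2/p}+(p-1)\sum_{k=2}^n\big(a_{n-k}(n-k)\big)^2\big(A_k(p)\big)^{2/p}.$$
   Context: Let $(\mathcal X,d)$ and $(\mathcal Y,\delta)$ be complete separable metric spaces. Let $(\varepsilon_i)_{i\ge1}$ be independent (not necessarily identically distributed) $\mathcal Y$-valued random variables, with $P_{\varepsilon_k}$ the law of $\varepsilon_k$. Let $(X_i)_{i\le0}$ be a deterministic sequence in $\mathcal X$. For each $m\ge1$ let $F_m:\mathcal X^{\mathbb N}\times\mathcal Y\to\mathcal X$ be measurable, and define recursively $X_m=F_m((X_{m-i})_{i\ge1};\varepsilon_m)$ for $m\ge1$. Assume there are nonnegative numbers $a_i$, $i\ge1$, with $\sum_{i\ge1}a_i<1$, such that for all $m\ge1$ and all sequences $(x_{m-i})_{i\ge1},(x'_{m-i})_{i\ge1}$ in $\mathcal X$, $$\mathbb E\big[d\big(F_m((x_{m-i})_{i\ge1};\varepsilon_m),F_m((x'_{m-i})_{i\ge1};\varepsilon_m)\big)\big]\le\sum_{i=1}^\infty a_i\,d(x_{m-i},x'_{m-i}).$$ Fix $n\ge1$ and let $f:\mathcal X^n\to\mathbb R$ satisfy $|f(x_1,\ldots,x_n)-f(x'_1,\ldots,x'_n)|\le\sum_{i=1}^n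 d(x_i,x'_i)$. Put $S_n=f(X_1,\ldots,X_n)-\mathbb E[f(X_1,\ldots,X_n)]$, and $\|Z\|_p=(\mathbb E|Z|^p)^{1/p}$. The numbers $a_k(k)$, $k\ge0$, are defined recursively by $a_0(0)=1$ and $a_k(k)=1+a_k+\sum_{l=1}^{k-1}a_l(l)\,a_{k-l}$ for $k\ge1$ (so $a_1(1)=1+a_1$). For $k\ge1$, $$H_{k,\varepsilon_k}(X_{k-1},\ldots,X_1,\varepsilon_k)=\int d\big(F_k(X_{k-1},\ldots,X_1,X_0,X_{-1},\ldots;\varepsilon_k),F_k(X_{k-1},\ldots,X_1,X_0,X_{-1},\ldots;y)\big)P_{\varepsilon_k}(dy),$$ which for $k=1$ is $H_{1,\varepsilon_1}(\varepsilon_1)=\int d(F_1(X_0,X_{-1},\ldots;\varepsilon_1),F_1(X_0,X_{-1},\ldots;y))P_{\varepsilon_1}(dy)$. *)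

theory Defs
  imports "HOL-Probability.Probability"
begin

text \<open>Real powers on \<^typ>\<open>ennreal\<close>, for exponents \<open>p > 0\<close>.\<close>

definition epowr :: "ennreal \<Rightarrow> real \<Rightarrow> ennreal" where
  "epowr x p = (if x = \<top> then \<top> else ennreal (enn2real x powr p))"

text \<open>The norm takes the value \<open>\<infinity>\<close> when the \<open>p\<close>-th absolute moment is infinite.
  Hence, on a probability space with \<open>p \<ge> 1\<close>, a finite bound on the norm of
  \<open>Z - c\<close> for some real \<open>c\<close> and measurable \<open>Z\<close> entails that \<open>Z\<close> is integrable.\<close>

definition Lp_norm :: "'w measure \<Rightarrow> real \<Rightarrow> ('w \<Rightarrow> real) \<Rightarrow> ennreal" where
  "Lp_norm M p Z = epowr (\<integral>\<^sup>+ \<omega>. ennreal (\<bar>Z \<omega>\<bar> powr p) \<partial>M) (1 / p)"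

text \<open>The sequence \<open>(X\<^bsub>m-i\<^esub>)\<close>, \<open>i \<ge> 1\<close>. Throughout, a sequence indexed by
  \<open>i \<ge> 1\<close> is a function on \<^typ>\<open>nat\<close> whose value at \<open>j\<close> is the entry with index
  \<open>i = j + 1\<close>.\<close>

definition past :: "(int \<Rightarrow> 'w \<Rightarrow> 'x) \<Rightarrow> nat \<Rightarrow> 'w \<Rightarrow> (nat \<Rightarrow> 'x)" where
  "past X m \<omega> = (\<lambda>j. X (int m - (int j + 1)) \<omega>)"

text \<open>\<open>acoef a k\<close> is the number \<open>a\<^sub>k(k)\<close>; the value \<open>a 0\<close> is never used.\<close>

fun acoef :: "(nat \<Rightarrow> real) \<Rightarrow> nat \<Rightarrow> real" where
  "acoef a 0 = 1"
| "acoef a (Suc k) = 1 + a (Suc k) + (\<Sum>l = 1..k. acoef a l * a (Suc k - l))"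

text \<open>The integral may be infinite, so \<open>H\<close> is \<^typ>\<open>ennreal\<close>-valued. The argument \<open>x\<close> is
  the whole past \<open>(X\<^bsub>k-1\<^esub>, \<dots>, X\<^sub>1, X\<^sub>0, X\<^bsub>-1\<^esub>, \<dots>)\<close>, including the deterministic part,
  and \<open>\<mu>\<close> is the law of \<open>\<epsilon>\<^sub>k\<close>.\<close>

definition H :: "(nat \<Rightarrow> (nat \<Rightarrow> 'x::metric_space) \<Rightarrow> 'y \<Rightarrow> 'x) \<Rightarrow> 'y measure \<Rightarrow> nat
    \<Rightarrow> (nat \<Rightarrow> 'x) \<Rightarrow> 'y \<Rightarrow> ennreal" where
  "H F \<mu> k x e = (\<integral>\<^sup>+ y. ennreal (dist (F k x e) (F k x y)) \<partial>\<mu>)"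

text \<open>The quantity \<open>A(n,p)\<close> built from constants \<open>A k = A\<^sub>k(p)\<close>.\<close>

definition Abound :: "(nat \<Rightarrow> real) \<Rightarrow> (nat \<Rightarrow> real) \<Rightarrow> nat \<Rightarrow> real \<Rightarrow> real" where
  "Abound a A n p = (acoef a (n - 1))\<^sup>2 * A 1 powr (2 / p)
     + (p - 1) * (\<Sum>k = 2..n. (acoef a (n - k))\<^sup>2 * A k powr (2 / p))"

end

theory Submission
  imports Defs
begin

text \<open>The deviation \<open>S\<^sub>n\<close> is the sum of the Doob martingale increments of \<open>f (X\<^sub>1, \<dots>, X\<^sub>n)\<close>. Integrating out
  \<open>\<epsilon>\<^sub>n, \<epsilon>\<^bsub>n-1\<^esub>, \<dots>\<close> one after the other, the contraction hypothesis shows that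
  \<open>E[f(X\<^sub>1, \<dots>, X\<^sub>n) | X\<^sub>1, \<dots>, X\<^sub>k]\<close> is Lipschitz in \<open>X\<^sub>k\<close> with constant \<open>a\<^bsub>n-k\<^esub>(n-k)\<close>, so that the
  \<open>k\<close>-th increment is at most \<open>a\<^bsub>n-k\<^esub>(n-k) H\<^sub>k\<close>. The increments are combined with Rio's inequality
  \<open>\<parallel>Z + D\<parallel>\<^sub>p\<^sup>2 \<le> \<parallel>Z\<parallel>\<^sub>p\<^sup>2 + (p - 1) \<parallel>D\<parallel>\<^sub>p\<^sup>2\<close> for conditionally centred \<open>D\<close>. It follows from the
  two-point inequality \<open>(|a + b|\<^sup>p + |a - b|\<^sup>p) / 2 \<le> (a\<^sup>2 + (p - 1) b\<^sup>2)\<^bsup>p/2\<^esup>\<close>, which together with Minkowski's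
  inequality in \<open>L\<^bsup>p/2\<^esup>\<close> makes the squared \<open>L\<^sup>p\<close> norm satisfy a parallelogram inequality.\<close>

section \<open>The two-point inequality\<close>

text \<open>A convex function lies above its tangents. Zero is treated apart, so that the derivative
  is taken at a positive point.\<close>

lemma powr_above_tangent:
  fixes c u q :: real
  assumes "c \<ge> 0" "u \<ge> 0" "q \<ge> 1"
  shows "c powr q + q * c powr (q - 1) * (u - c) \<le> u powr q"
proof (cases "c = 0 \<or> u = 0")
  case True
  moreover have "c * c powr (q - 1) = c powr q"
    using assms by (cases "c = 0") (auto simp: powr_mult_base)
  moreover have "c powr q \<le> q * c powr q"
    using assms by (simp add: mult_le_cancel_right1)
  ultimately show ?thesis
    by (auto simp: algebra_simps)
next
  case False
  with assms have pos: "c > 0" "u > 0" by auto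
  have "(\<lambda>x. x powr q) u - (\<lambda>x. x powr q) c \<ge> (q * c powr (q - 1)) * (u - c)"
    by (rule convex_on_imp_above_tangent[OF powr_convex[OF assms(3)]])
       (use pos in \<open>auto intro!: derivative_eq_intros
          simp: has_field_derivative_at_within interior_open\<close>)
  then show ?thesis by simp
qed

text \<open>Both tangent inequalities are taken at the mean \<open>c\<close> and averaged with
  weights \<open>l\<close> and \<open>1 - l\<close>; the linear terms then cancel.\<close>

lemma powr_convex_comb:
  fixes x y l q :: real
  assumes "x \<ge> 0" "y \<ge> 0" "q \<ge> 1" "0 \<le> l" "l \<le> 1"
  shows "(l * x + (1 - l) * y) powr q \<le> l * x powr q + (1 - l) * y powr q"
proof -
  define c where "c = l * x + (1 - l) * y"
  have c: "c \<ge> 0" using assms by (simp add: c_def)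
  have "l * (c powr q + q * c powr (q - 1) * (x - c))
      + (1 - l) * (c powr q + q * c powr (q - 1) * (y - c))
      \<le> l * x powr q + (1 - l) * y powr q"
    using assms c by (intro add_mono mult_left_mono powr_above_tangent) auto
  moreover have "l * (c powr q + q * c powr (q - 1) * (x - c))
      + (1 - l) * (c powr q + q * c powr (q - 1) * (y - c))
      = c powr q + q * c powr (q - 1) * (l * x + (1 - l) * y - c)"
    by (simp add: algebra_simps)
  ultimately show ?thesis by (simp add: c_def)
qed

lemma powr_add_le_two_powr:
  fixes x y q :: real
  assumes "x \<ge> 0" "y \<ge> 0" "q \<ge> 1"
  shows "(x + y) powr q \<le> 2 powr (q - 1) * (x powr q + y powr q)"
proof -
  have "((x + y) / 2) powr q \<le> (x powr q + y powr q) / 2"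
    using powr_convex_comb[of x y q "1/2"] assms by (simp add: add_divide_distrib)
  then show ?thesis
    using assms by (simp add: powr_divide powr_diff field_simps)
qed

text \<open>With \<open>q = p - 1\<close> this is the sign of the derivative met in
  \<open>two_point_unit\<close>. The difference \<open>g\<close> of the two sides vanishes at
  \<open>0\<close> and has derivative \<open>q * (q + 1) * s * ((1 + s) powr (q - 1) - (1 - s) powr
  (q - 1))\<close>, which is nonnegative.\<close>

lemma two_point_aux:
  fixes q t :: real
  assumes "q \<ge> 1" "0 \<le> t" "t < 1"
  shows "(1 + t) powr q * (1 - q * t) \<le> (1 - t) powr q * (1 + q * t)"
proof -
  define g where "g = (\<lambda>s::real. (1 - s) powr q * (1 + q * s) - (1 + s) powr q * (1 - q * s))"
  have "g 0 \<le> g t"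
  proof (rule DERIV_nonneg_imp_nondecreasing[of 0 t g])
    fix s assume s: "0 \<le> s" "s \<le> t"
    have P: "(1 + s) powr q = (1 + s) * (1 + s) powr (q - 1)"
      "(1 - s) powr q = (1 - s) * (1 - s) powr (q - 1)"
      using s assms by (simp_all add: powr_mult_base)
    have "(g has_real_derivative
        (- (q * (1 - s) powr (q - 1)) * (1 + q * s) + (1 - s) powr q * q)
        - (q * (1 + s) powr (q - 1) * (1 - q * s) - (1 + s) powr q * q)) (at s)"
      unfolding g_def using s assms
      by (auto intro!: derivative_eq_intros)
    also have "(- (q * (1 - s) powr (q - 1)) * (1 + q * s) + (1 - s) powr q * q)
        - (q * (1 + s) powr (q - 1) * (1 - q * s) - (1 + s) powr q * q)
      = q * (q + 1) * s * ((1 + s) powr (q - 1) - (1 - s) powr (q - 1))"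
      unfolding P by (simp add: algebra_simps)
    finally have "(g has_real_derivative
        q * (q + 1) * s * ((1 + s) powr (q - 1) - (1 - s) powr (q - 1))) (at s)" .
    moreover have "(1 - s) powr (q - 1) \<le> (1 + s) powr (q - 1)"
      using s assms by (intro powr_mono2) auto
    ultimately show "\<exists>y. (g has_real_derivative y) (at s) \<and> 0 \<le> y"
      using s assms
      by (intro exI[of _ "q * (q + 1) * s * ((1 + s) powr (q - 1) - (1 - s) powr (q - 1))"] conjI) auto
  qed (use assms in auto)
  then show ?thesis by (simp add: g_def)
qed

text \<open>The quotient \<open>g\<close> of \<open>(1 + s) powr p + (1 - s) powr p\<close> by the
  power on the right equals \<open>2\<close> at \<open>0\<close> and is nonincreasing.\<close>

lemma two_point_unit:
  fixes p t :: real
  assumes "p \<ge> 2" "0 \<le> t" "t \<le> 1"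
  shows "((1 + t) powr p + (1 - t) powr p) / 2 \<le> (1 + (p - 1) * t\<^sup>2) powr (p / 2)"
proof -
  define g where "g = (\<lambda>s::real. (1 + (p - 1) * s\<^sup>2) powr (- (p / 2)) * ((1 + s) powr p + (1 - s) powr p))"
  have pos: "1 + (p - 1) * s\<^sup>2 > 0" for s
    using assms by (intro add_pos_nonneg) auto
  \<comment> \<open>The derivative is examined only on the open interval, because the base
    \<open>1 - s\<close> reaches zero at the right end when \<open>t = 1\<close>.\<close>
  have "- g 0 \<le> - g t"
  proof (rule DERIV_nonneg_imp_increasing_open[of 0 t "\<lambda>s. - g s"])
    fix s assume s: "0 < s" "s < t"
    define R where "R = 1 + (p - 1) * s\<^sup>2"
    have R: "R > 0" using pos by (simp add: R_def)
    define a where "a = (1 + s) powr (p - 1)"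
    define b where "b = (1 - s) powr (p - 1)"
    have P: "(1 + s) powr p = (1 + s) * a" "(1 - s) powr p = (1 - s) * b"
      using s assms by (simp_all add: powr_mult_base a_def b_def)
    have "((\<lambda>s. - g s) has_real_derivative
        - ((- (p / 2)) * R powr (- (p / 2) - 1) * ((p - 1) * (2 * s)) * ((1 + s) powr p + (1 - s) powr p)
         + R powr (- (p / 2)) * (p * a - p * b))) (at s)"
      unfolding g_def using s assms pos
      by (auto intro!: derivative_eq_intros simp: R_def a_def b_def)
    also have "- ((- (p / 2)) * R powr (- (p / 2) - 1) * ((p - 1) * (2 * s)) * ((1 + s) powr p + (1 - s) powr p)
         + R powr (- (p / 2)) * (p * a - p * b))
       = R powr (- (p / 2) - 1) * p * ((p - 1) * s * ((1 + s) * a + (1 - s) * b) - R * (a - b))"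
    proof -
      have "R powr (- (p / 2)) = R * R powr (- (p / 2) - 1)"
        using R by (simp add: powr_mult_base)
      then show ?thesis unfolding P by (simp add: field_simps)
    qed
    \<comment> \<open>The terms quadratic in \<open>s\<close> cancel against those of
      \<open>R\<close>, which leaves exactly the difference controlled by
      \<open>two_point_aux\<close>.\<close>
    also have "(p - 1) * s * ((1 + s) * a + (1 - s) * b) - R * (a - b)
      = b * (1 + (p - 1) * s) - a * (1 - (p - 1) * s)"
      by (simp add: R_def algebra_simps power2_eq_square)
    finally have "((\<lambda>s. - g s) has_real_derivative
       R powr (- (p / 2) - 1) * p * (b * (1 + (p - 1) * s) - a * (1 - (p - 1) * s))) (at s)" .
    moreover have "a * (1 - (p - 1) * s) \<le> b * (1 + (p - 1) * s)"
      unfolding a_def b_def using s assms by (intro two_point_aux) auto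
    ultimately show "\<exists>y. ((\<lambda>s. - g s) has_real_derivative y) (at s) \<and> 0 \<le> y"
      using assms
      by (intro exI[of _ "R powr (- (p / 2) - 1) * p * (b * (1 + (p - 1) * s) - a * (1 - (p - 1) * s))"]
          conjI) auto
  next
    show "continuous_on {0..t} (\<lambda>s. - g s)"
      unfolding g_def using assms pos less_imp_le[OF pos] less_imp_neq[OF pos]
      by (intro continuous_on_minus continuous_on_mult continuous_on_add continuous_on_powr'
          continuous_on_diff continuous_on_const continuous_on_id continuous_on_power) auto
  qed (use assms in auto)
  moreover have "g 0 = 2" by (simp add: g_def)
  ultimately have "(1 + (p - 1) * t\<^sup>2) powr (- (p / 2)) * ((1 + t) powr p + (1 - t) powr p) \<le> 2"
    by (simp add: g_def)
  then show ?thesis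
    using pos[of t] by (simp add: powr_minus field_simps)
qed

text \<open>The left side depends only on the absolute values of \<open>a\<close> and
  \<open>b\<close> and is symmetric in them, and both sides are homogeneous, so the larger one can
  be scaled to \<open>1\<close>. If \<open>b\<close> is the larger, exchanging the two gives the
  weight \<open>p - 1\<close> to the smaller square; since \<open>p - 1\<close> is at least
  \<open>1\<close>, moving it to the larger square only increases the bound.\<close>

lemma two_point_inequality:
  fixes a b p :: real
  assumes "p \<ge> 2"
  shows "(\<bar>a + b\<bar> powr p + \<bar>a - b\<bar> powr p) / 2 \<le> (a\<^sup>2 + (p - 1) * b\<^sup>2) powr (p / 2)"
proof -
  have *: "((x + y) powr p + (x - y) powr p) / 2 \<le> (x\<^sup>2 + (p - 1) * y\<^sup>2) powr (p / 2)"
    if "0 \<le> y" "y \<le> x" for x y :: real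
  proof (cases "x = 0")
    case True
    then show ?thesis using that by auto
  next
    case False
    with that have x: "x > 0" by auto
    have "x powr p * (((1 + y / x) powr p + (1 - y / x) powr p) / 2)
        \<le> x powr p * (1 + (p - 1) * (y / x)\<^sup>2) powr (p / 2)"
      using that x assms by (intro mult_left_mono two_point_unit) auto
    moreover have "x powr p * (((1 + y / x) powr p + (1 - y / x) powr p) / 2)
      = ((x + y) powr p + (x - y) powr p) / 2"
    proof -
      have "x * (1 + y / x) = x + y" "x * (1 - y / x) = x - y"
        using x by (simp_all add: field_simps)
      moreover have "x powr p * (1 + y / x) powr p = (x * (1 + y / x)) powr p"
        "x powr p * (1 - y / x) powr p = (x * (1 - y / x)) powr p"
        using that x by (simp_all add: powr_mult)
      ultimately show ?thesis by (simp add: algebra_simps)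
    qed
    moreover have "x powr p * (1 + (p - 1) * (y / x)\<^sup>2) powr (p / 2)
      = (x\<^sup>2 + (p - 1) * y\<^sup>2) powr (p / 2)"
    proof -
      have "x powr p = (x\<^sup>2) powr (p / 2)"
        using x by (simp add: powr_powr flip: powr_numeral)
      then have "x powr p * (1 + (p - 1) * (y / x)\<^sup>2) powr (p / 2)
          = (x\<^sup>2 * (1 + (p - 1) * (y / x)\<^sup>2)) powr (p / 2)"
        by (simp add: powr_mult)
      also have "x\<^sup>2 * (1 + (p - 1) * (y / x)\<^sup>2) = x\<^sup>2 + (p - 1) * y\<^sup>2"
        using x by (simp add: field_simps power2_eq_square)
      finally show ?thesis .
    qed
    ultimately show ?thesis by simp
  qed
  have sym: "\<bar>a + b\<bar> powr p + \<bar>a - b\<bar> powr p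
      = (\<bar>a\<bar> + \<bar>b\<bar>) powr p + \<bar>\<bar>a\<bar> - \<bar>b\<bar>\<bar> powr p"
    by (cases "a \<ge> 0"; cases "b \<ge> 0"; cases "\<bar>a\<bar> \<le> \<bar>b\<bar>")
       (auto simp: abs_if algebra_simps)
  show ?thesis
  proof (cases "\<bar>b\<bar> \<le> \<bar>a\<bar>")
    case True
    then show ?thesis using *[of "\<bar>b\<bar>" "\<bar>a\<bar>"] sym by simp
  next
    case False
    then have "(\<bar>a + b\<bar> powr p + \<bar>a - b\<bar> powr p) / 2 \<le> (b\<^sup>2 + (p - 1) * a\<^sup>2) powr (p / 2)"
      using *[of "\<bar>a\<bar>" "\<bar>b\<bar>"] sym by (simp add: add.commute abs_minus_commute)
    also have "\<dots> \<le> (a\<^sup>2 + (p - 1) * b\<^sup>2) powr (p / 2)"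
    proof (intro powr_mono2)
      have "a\<^sup>2 \<le> b\<^sup>2" using False by (simp add: abs_le_square_iff)
      then have "(p - 2) * a\<^sup>2 \<le> (p - 2) * b\<^sup>2"
        using assms by (intro mult_left_mono) auto
      then show "b\<^sup>2 + (p - 1) * a\<^sup>2 \<le> a\<^sup>2 + (p - 1) * b\<^sup>2"
        by (simp add: algebra_simps)
    qed (use assms in auto)
    finally show ?thesis .
  qed
qed

section \<open>Moment inequality for centred increments\<close>

text \<open>The sum is a multiple of a convex combination of the normalized functions, with weights
  proportional to the norms; convexity of the power then bounds its integral.\<close>

lemma minkowski_powr:
  fixes X Y :: "'a \<Rightarrow> real"
  assumes [measurable]: "X \<in> borel_measurable M" "Y \<in> borel_measurable M"
    and nonneg: "\<And>x. X x \<ge> 0" "\<And>x. Y x \<ge> 0" and q: "q \<ge> 1"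
    and int: "integrable M (\<lambda>x. X x powr q)" "integrable M (\<lambda>x. Y x powr q)"
  shows "integrable M (\<lambda>x. (X x + Y x) powr q)"
    and "(\<integral>x. (X x + Y x) powr q \<partial>M) powr (1 / q)
      \<le> (\<integral>x. X x powr q \<partial>M) powr (1 / q) + (\<integral>x. Y x powr q \<partial>M) powr (1 / q)"
proof -
  show int': "integrable M (\<lambda>x. (X x + Y x) powr q)"
  proof (rule Bochner_Integration.integrable_bound)
    show "integrable M (\<lambda>x. 2 powr (q - 1) * (X x powr q + Y x powr q))"
      using int by auto
    show "AE x in M. norm ((X x + Y x) powr q) \<le> norm (2 powr (q - 1) * (X x powr q + Y x powr q))"
      using powr_add_le_two_powr[OF nonneg q] by auto
  qed simp
  define \<alpha> where "\<alpha> = (\<integral>x. X x powr q \<partial>M) powr (1 / q)"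
  define \<beta> where "\<beta> = (\<integral>x. Y x powr q \<partial>M) powr (1 / q)"
  have \<alpha>: "\<alpha> \<ge> 0" "(\<integral>x. X x powr q \<partial>M) = \<alpha> powr q"
    using q by (auto simp: \<alpha>_def powr_powr intro!: integral_nonneg_AE)
  have \<beta>: "\<beta> \<ge> 0" "(\<integral>x. Y x powr q \<partial>M) = \<beta> powr q"
    using q by (auto simp: \<beta>_def powr_powr intro!: integral_nonneg_AE)
  show "(\<integral>x. (X x + Y x) powr q \<partial>M) powr (1 / q)
      \<le> (\<integral>x. X x powr q \<partial>M) powr (1 / q) + (\<integral>x. Y x powr q \<partial>M) powr (1 / q)"
    unfolding \<alpha>_def[symmetric] \<beta>_def[symmetric]
  proof (rule field_le_epsilon)
    fix e :: real assume e: "e > 0"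
    \<comment> \<open>The added \<open>e / 2\<close> keeps both normalizing constants positive even
      if a norm is zero.\<close>
    define a b where "a = \<alpha> + e / 2" and "b = \<beta> + e / 2"
    have ab: "a > 0" "b > 0" using \<alpha> \<beta> e by (auto simp: a_def b_def add_nonneg_pos)
    define l where "l = a / (a + b)"
    have l: "0 \<le> l" "l \<le> 1" "l * (a + b) = a" "(1 - l) * (a + b) = b"
      using ab by (auto simp: l_def field_simps)
    have pw: "(X x + Y x) powr q
        \<le> (a + b) powr q * (l * (X x powr q / a powr q) + (1 - l) * (Y x powr q / b powr q))" for x
    proof -
      have "X x + Y x = (a + b) * (l * (X x / a) + (1 - l) * (Y x / b))"
      proof -
        have "(a + b) * (l * (X x / a) + (1 - l) * (Y x / b))
            = (l * (a + b)) * (X x / a) + ((1 - l) * (a + b)) * (Y x / b)"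
          by (simp only: algebra_simps)
        then show ?thesis using l ab by simp
      qed
      then have "(X x + Y x) powr q = (a + b) powr q * (l * (X x / a) + (1 - l) * (Y x / b)) powr q"
        using ab l nonneg by (simp add: powr_mult)
      also have "\<dots> \<le> (a + b) powr q * (l * (X x / a) powr q + (1 - l) * (Y x / b) powr q)"
        using ab l q nonneg by (intro mult_left_mono powr_convex_comb) auto
      finally show ?thesis using ab nonneg by (simp add: powr_divide)
    qed
    have "(\<integral>x. (X x + Y x) powr q \<partial>M)
        \<le> (\<integral>x. (a + b) powr q * (l * (X x powr q / a powr q) + (1 - l) * (Y x powr q / b powr q)) \<partial>M)"
      using int by (intro integral_mono int' pw) auto
    also have "\<dots> = (a + b) powr q * (l * (\<alpha> powr q / a powr q) + (1 - l) * (\<beta> powr q / b powr q))"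
      using int by (simp add: \<alpha> \<beta>)
    also have "\<dots> \<le> (a + b) powr q * (l * 1 + (1 - l) * 1)"
    proof -
      have "\<alpha> powr q \<le> a powr q" "\<beta> powr q \<le> b powr q"
        using e q \<alpha> \<beta> by (auto simp: a_def b_def intro!: powr_mono2)
      then show ?thesis
        using ab l by (intro mult_left_mono add_mono) (auto simp: divide_le_eq_1)
    qed
    finally have "(\<integral>x. (X x + Y x) powr q \<partial>M) \<le> (a + b) powr q" by simp
    then have "(\<integral>x. (X x + Y x) powr q \<partial>M) powr (1 / q) \<le> ((a + b) powr q) powr (1 / q)"
      using q by (intro powr_mono2) (auto intro!: integral_nonneg_AE)
    also have "\<dots> = \<alpha> + \<beta> + e"
      using ab q by (simp add: powr_powr) (simp add: a_def b_def)
    finally show "(\<integral>x. (X x + Y x) powr q \<partial>M) powr (1 / q) \<le> \<alpha> + \<beta> + e" .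
  qed
qed

lemma integrable_powr_add_abs:
  fixes X Y :: "'a \<Rightarrow> real"
  assumes [measurable]: "X \<in> borel_measurable M" "Y \<in> borel_measurable M"
    and p: "p \<ge> 1"
    and int: "integrable M (\<lambda>x. \<bar>X x\<bar> powr p)" "integrable M (\<lambda>x. \<bar>Y x\<bar> powr p)"
  shows "integrable M (\<lambda>x. \<bar>X x + Y x\<bar> powr p)"
proof (rule Bochner_Integration.integrable_bound)
  show "integrable M (\<lambda>x. (\<bar>X x\<bar> + \<bar>Y x\<bar>) powr p)"
    using assms by (intro minkowski_powr) auto
  show "AE x in M. norm (\<bar>X x + Y x\<bar> powr p) \<le> norm ((\<bar>X x\<bar> + \<bar>Y x\<bar>) powr p)"
    using p by (auto intro!: powr_mono2)
qed simp

section \<open>Squared \<open>L^p\<close> norms and their smoothness\<close>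

definition sqnorm :: "'a measure \<Rightarrow> real \<Rightarrow> ('a \<Rightarrow> real) \<Rightarrow> real" where
  "sqnorm M p Z = (\<integral>x. \<bar>Z x\<bar> powr p \<partial>M) powr (2 / p)"

lemma sqnorm_scale:
  assumes "p > 0"
  shows "sqnorm M p (\<lambda>x. t * Z x) = t\<^sup>2 * sqnorm M p Z"
proof -
  have "(\<bar>t\<bar> powr p) powr (2 / p) = t\<^sup>2"
    using assms by (simp add: powr_powr)
  then show ?thesis
    by (simp add: sqnorm_def abs_mult powr_mult)
qed

text \<open>Convexity of the power \<open>p / 2\<close> bounds the mean of the two squared norms by
  a power of the mean of the two integrals. The two-point inequality is then integrated, and
  Minkowski in exponent \<open>p / 2\<close> separates the squares of \<open>X\<close> and
  \<open>Y\<close>.\<close>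

lemma sqnorm_parallelogram:
  assumes [measurable]: "X \<in> borel_measurable M" "Y \<in> borel_measurable M"
    and p: "p \<ge> 2"
    and int: "integrable M (\<lambda>x. \<bar>X x\<bar> powr p)" "integrable M (\<lambda>x. \<bar>Y x\<bar> powr p)"
  shows "sqnorm M p (\<lambda>x. X x + Y x) + sqnorm M p (\<lambda>x. X x - Y x)
    \<le> 2 * sqnorm M p X + 2 * (p - 1) * sqnorm M p Y"
proof -
  define u where "u = (\<integral>x. \<bar>X x + Y x\<bar> powr p \<partial>M)"
  define v where "v = (\<integral>x. \<bar>X x - Y x\<bar> powr p \<partial>M)"
  have int_add: "integrable M (\<lambda>x. \<bar>X x + Y x\<bar> powr p)"
    using p int by (intro integrable_powr_add_abs) auto
  have int_diff: "integrable M (\<lambda>x. \<bar>X x - Y x\<bar> powr p)"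
    using p int integrable_powr_add_abs[of X M "\<lambda>x. - Y x" p] by auto
  have sq: "(z\<^sup>2) powr (p / 2) = \<bar>z\<bar> powr p" for z :: real
  proof -
    have "z\<^sup>2 = \<bar>z\<bar> powr 2" by simp
    then show ?thesis by (simp only: powr_powr) simp
  qed
  have sq': "((p - 1) * z\<^sup>2) powr (p / 2) = (p - 1) powr (p / 2) * \<bar>z\<bar> powr p" for z :: real
    using p by (simp add: powr_mult sq)
  have nonneg: "u \<ge> 0" "v \<ge> 0"
    by (auto simp: u_def v_def intro!: integral_nonneg_AE)
  have "((u powr (2 / p) + v powr (2 / p)) / 2) powr (p / 2) \<le> (u + v) / 2"
    using powr_convex_comb[of "u powr (2 / p)" "v powr (2 / p)" "p / 2" "1 / 2"] p nonneg
    by (simp add: powr_powr add_divide_distrib)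
  then have "(((u powr (2 / p) + v powr (2 / p)) / 2) powr (p / 2)) powr (2 / p) \<le> ((u + v) / 2) powr (2 / p)"
    using p by (intro powr_mono2) auto
  then have "(u powr (2 / p) + v powr (2 / p)) / 2 \<le> ((u + v) / 2) powr (2 / p)"
    using p by (simp add: powr_powr)
  also have "(u + v) / 2 = (\<integral>x. (\<bar>X x + Y x\<bar> powr p + \<bar>X x - Y x\<bar> powr p) / 2 \<partial>M)"
    using int_add int_diff by (simp add: u_def v_def)
  also have "\<dots> powr (2 / p) \<le> (\<integral>x. ((X x)\<^sup>2 + (p - 1) * (Y x)\<^sup>2) powr (p / 2) \<partial>M) powr (2 / p)"
    using p int int_add int_diff
    by (intro powr_mono2 integral_mono two_point_inequality minkowski_powr)
       (auto simp: sq sq' intro!: integral_nonneg_AE)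
  also have "\<dots> \<le> (\<integral>x. ((X x)\<^sup>2) powr (p / 2) \<partial>M) powr (1 / (p / 2))
      + (\<integral>x. ((p - 1) * (Y x)\<^sup>2) powr (p / 2) \<partial>M) powr (1 / (p / 2))"
    using minkowski_powr(2)[of "\<lambda>x. (X x)\<^sup>2" M "\<lambda>x. (p - 1) * (Y x)\<^sup>2" "p / 2"] p int
    by (simp add: sq sq')
  also have "\<dots> = sqnorm M p X + (p - 1) * sqnorm M p Y"
    using p by (simp add: sq sq' sqnorm_def powr_mult powr_powr)
  finally show ?thesis
    by (simp add: sqnorm_def u_def v_def field_simps)
qed

text \<open>A crude form of Young's inequality suffices: \<open>u powr (p - 1) * v\<close> is at
  most the \<open>p\<close>-th power of the larger of \<open>u\<close> and \<open>v\<close>.\<close>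

lemma integrable_powr_sgn_mult:
  fixes X Y :: "'a \<Rightarrow> real"
  assumes [measurable]: "X \<in> borel_measurable M" "Y \<in> borel_measurable M"
    and p: "p \<ge> 1"
    and int: "integrable M (\<lambda>x. \<bar>X x\<bar> powr p)" "integrable M (\<lambda>x. \<bar>Y x\<bar> powr p)"
  shows "integrable M (\<lambda>x. sgn (X x) * \<bar>X x\<bar> powr (p - 1) * Y x)"
proof (rule Bochner_Integration.integrable_bound)
  show "integrable M (\<lambda>x. \<bar>X x\<bar> powr p + \<bar>Y x\<bar> powr p)"
    using int by auto
  have le: "u powr (p - 1) * v \<le> u powr p + v powr p" if "u > 0" "v \<ge> 0" for u v :: real
  proof (cases "u \<le> v")
    case True
    then have "u powr (p - 1) * v \<le> v powr (p - 1) * v"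
      using that p by (intro mult_right_mono powr_mono2) auto
    also have "\<dots> = v powr p"
      using that True by (simp add: powr_mult_base mult.commute)
    finally show ?thesis using powr_ge_zero[of u p] by linarith
  next
    case False
    then have "u powr (p - 1) * v \<le> u powr (p - 1) * u"
      by (intro mult_left_mono) auto
    also have "\<dots> = u powr p"
      using that by (simp add: powr_mult_base mult.commute)
    finally show ?thesis using powr_ge_zero[of v p] by linarith
  qed
  show "AE x in M. norm (sgn (X x) * \<bar>X x\<bar> powr (p - 1) * Y x) \<le> norm (\<bar>X x\<bar> powr p + \<bar>Y x\<bar> powr p)"
  proof (rule AE_I2)
    fix x
    show "norm (sgn (X x) * \<bar>X x\<bar> powr (p - 1) * Y x) \<le> norm (\<bar>X x\<bar> powr p + \<bar>Y x\<bar> powr p)"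
      using le[of "\<bar>X x\<bar>" "\<bar>Y x\<bar>"] by (cases "X x = 0") (auto simp: abs_mult abs_sgn_eq)
  qed
qed simp

text \<open>The tangent to the \<open>p\<close>-th power of the absolute value at \<open>Z x\<close>
  bounds the integrand from below, and \<open>orth\<close> says that its linear term integrates to
  zero.\<close>

lemma sqnorm_le_orthogonal:
  assumes [measurable]: "Z \<in> borel_measurable M" "D \<in> borel_measurable M"
    and p: "p \<ge> 2"
    and int: "integrable M (\<lambda>x. \<bar>Z x\<bar> powr p)" "integrable M (\<lambda>x. \<bar>D x\<bar> powr p)"
    and orth: "(\<integral>x. sgn (Z x) * \<bar>Z x\<bar> powr (p - 1) * D x \<partial>M) = 0"
  shows "sqnorm M p Z \<le> sqnorm M p (\<lambda>x. Z x + t * D x)"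
proof -
  have intD: "integrable M (\<lambda>x. \<bar>t * D x\<bar> powr p)"
    using int by (simp add: abs_mult powr_mult)
  have pw: "\<bar>Z x\<bar> powr p + p * t * (sgn (Z x) * \<bar>Z x\<bar> powr (p - 1) * D x) \<le> \<bar>Z x + t * D x\<bar> powr p" for x
  proof (cases "Z x = 0")
    case False
    \<comment> \<open>\<open>u\<close> is the component of \<open>Z x + t * D x\<close> along the
      sign of \<open>Z x\<close>, hence at most its absolute value.\<close>
    define u where "u = sgn (Z x) * (Z x + t * D x)"
    have "u \<le> \<bar>Z x + t * D x\<bar>"
      by (auto simp: u_def sgn_if)
    moreover have "sgn (Z x) * (t * D x) = u - \<bar>Z x\<bar>"
      by (auto simp: u_def sgn_if)
    ultimately have "sgn (Z x) * (t * D x) \<le> \<bar>Z x + t * D x\<bar> - \<bar>Z x\<bar>" by simp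
    then have "\<bar>Z x\<bar> powr p + p * \<bar>Z x\<bar> powr (p - 1) * (sgn (Z x) * (t * D x))
        \<le> \<bar>Z x\<bar> powr p + p * \<bar>Z x\<bar> powr (p - 1) * (\<bar>Z x + t * D x\<bar> - \<bar>Z x\<bar>)"
      using p by (intro add_left_mono mult_left_mono) auto
    also have "\<dots> \<le> \<bar>Z x + t * D x\<bar> powr p"
      using p by (intro powr_above_tangent) auto
    finally show ?thesis by (simp add: algebra_simps)
  qed simp
  have intO: "integrable M (\<lambda>x. sgn (Z x) * \<bar>Z x\<bar> powr (p - 1) * D x)"
    using p int by (intro integrable_powr_sgn_mult) auto
  have "(\<integral>x. \<bar>Z x\<bar> powr p \<partial>M)
      = (\<integral>x. \<bar>Z x\<bar> powr p + p * t * (sgn (Z x) * \<bar>Z x\<bar> powr (p - 1) * D x) \<partial>M)"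
    using int intO orth by simp
  also have "\<dots> \<le> (\<integral>x. \<bar>Z x + t * D x\<bar> powr p \<partial>M)"
    using int intO intD p by (intro integral_mono pw integrable_powr_add_abs) auto
  finally show ?thesis
    unfolding sqnorm_def using p by (intro powr_mono2) (auto intro!: integral_nonneg_AE)
qed

text \<open>This is Rio's inequality. With \<open>\<phi>(t) = \<parallel>Z + t D\<parallel>\<^sub>p\<^sup>2\<close>, the parallelogram inequality at \<open>(0, s)\<close> and
  the minimality of \<open>\<phi>(0)\<close> bound \<open>\<phi>(s) - \<phi>(0)\<close> by \<open>2 (p - 1) s\<^sup>2 \<parallel>D\<parallel>\<^sub>p\<^sup>2\<close>; repeated doubling of \<open>s\<close>, starting from
  \<open>2\<^sup>-\<^sup>n\<close>, then removes the factor \<open>2\<close>. The integral in the last hypothesis is, up to the factor \<open>p\<close>,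
  the derivative of \<open>\<parallel>Z + t D\<parallel>\<^sub>p\<^sup>p\<close> at \<open>0\<close>.\<close>

lemma sqnorm_add_le_orthogonal:
  assumes meas [measurable]: "Z \<in> borel_measurable M" "D \<in> borel_measurable M"
    and p: "p \<ge> 2"
    and int: "integrable M (\<lambda>x. \<bar>Z x\<bar> powr p)" "integrable M (\<lambda>x. \<bar>D x\<bar> powr p)"
    and orth: "(\<integral>x. sgn (Z x) * \<bar>Z x\<bar> powr (p - 1) * D x \<partial>M) = 0"
  shows "sqnorm M p (\<lambda>x. Z x + D x) \<le> sqnorm M p Z + (p - 1) * sqnorm M p D"
proof -
  define \<phi> where "\<phi> = (\<lambda>t. sqnorm M p (\<lambda>x. Z x + t * D x))"
  define b where "b = (p - 1) * sqnorm M p D"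
  define \<psi> where "\<psi> = (\<lambda>t. \<phi> t - \<phi> 0 - t\<^sup>2 * b)"
  have intD: "integrable M (\<lambda>x. \<bar>t * D x\<bar> powr p)" for t
    using int by (simp add: abs_mult powr_mult)
  have intZ: "integrable M (\<lambda>x. \<bar>Z x + t * D x\<bar> powr p)" for t
    using p int intD by (intro integrable_powr_add_abs) auto
  have \<phi>0: "\<phi> 0 \<le> \<phi> t" for t
    unfolding \<phi>_def using sqnorm_le_orthogonal[OF meas p int orth, of t] by simp
  have par: "\<phi> (t + s) + \<phi> (t - s) \<le> 2 * \<phi> t + 2 * s\<^sup>2 * b" for t s
    using sqnorm_parallelogram[of "\<lambda>x. Z x + t * D x" M "\<lambda>x. s * D x" p] p intZ intD
    by (simp add: \<phi>_def b_def sqnorm_scale algebra_simps)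
  have small: "\<psi> s \<le> s\<^sup>2 * b" for s
    using par[of 0 s] \<phi>0[of "- s"] unfolding \<psi>_def minus_diff_eq diff_0 add_0 by linarith
  \<comment> \<open>Subtracting the quadratic \<open>t\<^sup>2 * b\<close> in \<open>\<psi>\<close>
    is what makes the term \<open>2 * s\<^sup>2 * b\<close> of \<open>par\<close> disappear
    here.\<close>
  have double: "\<psi> (2 * s) \<le> 2 * \<psi> s" for s
    using par[of s s] by (simp add: \<psi>_def power_mult_distrib mult_ac)
  have iter: "\<psi> 1 \<le> 2 ^ n * \<psi> ((1 / 2) ^ n)" for n
  proof (induction n)
    case (Suc n)
    also have "2 ^ n * \<psi> ((1 / 2) ^ n) \<le> 2 ^ n * (2 * \<psi> ((1 / 2) ^ Suc n))"
      using double[of "(1 / 2) ^ Suc n"] by (intro mult_left_mono) auto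
    finally show ?case by (simp add: algebra_simps)
  qed simp
  \<comment> \<open>The factor \<open>2 ^ n\<close> from doubling meets the squared step
    \<open>4 ^ (- n)\<close> from \<open>small\<close>, so the bound tends to zero.\<close>
  have "\<psi> 1 \<le> (1 / 2) ^ n * b" for n
  proof -
    have "\<psi> 1 \<le> 2 ^ n * (((1 / 2) ^ n)\<^sup>2 * b)"
      using iter[of n] small[of "(1 / 2) ^ n"]
      by (meson mult_left_mono order_trans zero_le_numeral zero_le_power)
    also have "\<dots> = (1 / 2) ^ n * b"
      by (simp add: power2_eq_square power_divide field_simps)
    finally show ?thesis .
  qed
  moreover have "(\<lambda>n. (1 / 2) ^ n * b) \<longlonglongrightarrow> 0 * b"
    by (intro tendsto_mult LIMSEQ_power_zero tendsto_const) auto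
  ultimately have "\<psi> 1 \<le> 0"
    by (intro LIMSEQ_le_const[of "\<lambda>n. (1 / 2) ^ n * b"]) auto
  then show ?thesis by (simp add: \<psi>_def \<phi>_def b_def)
qed

section \<open>Histories and conditional expectations of the recursion\<close>

text \<open>The bound makes \<open>f\<close> continuous for the product topology, whose Borel sets
  form the product sigma-algebra because the factors are Polish and the index set is
  countable.\<close>

lemma measurable_sum_dist_lipschitz:
  fixes f :: "(nat \<Rightarrow> 'x::polish_space) \<Rightarrow> real"
  assumes lip: "\<And>x x'. \<bar>f x - f x'\<bar> \<le> (\<Sum>i\<in>I. dist (x i) (x' i))"
  shows "f \<in> borel_measurable (\<Pi>\<^sub>M i\<in>UNIV. borel)"
proof -
  have "isCont f x" for x
  proof -
    have lim: "((\<lambda>y. y i) \<longlongrightarrow> x i) (at x)" for i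
    proof -
      have "continuous_on UNIV (\<lambda>y :: nat \<Rightarrow> 'x. y i)" by simp
      then show ?thesis by (simp add: continuous_on_def)
    qed
    have "((\<lambda>y. \<Sum>i\<in>I. dist (y i) (x i)) \<longlongrightarrow> (\<Sum>i\<in>I. dist (x i) (x i))) (at x)"
      by (intro tendsto_sum tendsto_dist lim tendsto_const)
    then have "((\<lambda>y. \<Sum>i\<in>I. dist (y i) (x i)) \<longlongrightarrow> 0) (at x)"
      by simp
    moreover have "\<forall>\<^sub>F y in at x. norm (f y - f x) \<le> (\<Sum>i\<in>I. dist (y i) (x i))"
      using lip[of _ x] by (intro always_eventually allI) (simp only: real_norm_def)
    ultimately have "((\<lambda>y. f y - f x) \<longlongrightarrow> 0) (at x)"
      by (rule Lim_null_comparison[rotated])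
    then show ?thesis
      unfolding isCont_def by (rule LIM_zero_cancel)
  qed
  then have "f \<in> borel_measurable borel"
    by (intro borel_measurable_continuous_onI) (simp add: continuous_at_imp_continuous_on)
  also have "borel_measurable (borel :: (nat \<Rightarrow> 'x) measure)
      = borel_measurable (\<Pi>\<^sub>M i\<in>UNIV. borel)"
    by (intro measurable_cong_sets sets_PiM_equal_borel[symmetric] refl)
  finally show ?thesis .
qed

text \<open>Independence turns the joint law into a product, so Fubini lets the integral over
  \<open>V\<close> be taken first, with \<open>u\<close> frozen. This replaces an abstract
  conditional expectation.\<close>

lemma (in prob_space) integral_indep_conditional_zero:
  fixes g :: "'s \<times> 's \<Rightarrow> real"
  assumes indep: "indep_var S U N V"
    and [measurable]: "g \<in> borel_measurable (S \<Otimes>\<^sub>M N)"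
    and int: "integrable M (\<lambda>\<omega>. g (U \<omega>, V \<omega>))"
    and zero: "\<And>u. u \<in> space S \<Longrightarrow> (\<integral>\<omega>. g (u, V \<omega>) \<partial>M) = 0"
  shows "(\<integral>\<omega>. g (U \<omega>, V \<omega>) \<partial>M) = 0"
proof -
  have [measurable]: "U \<in> M \<rightarrow>\<^sub>M S" "V \<in> M \<rightarrow>\<^sub>M N"
    using indep by (auto dest: indep_var_rv1 indep_var_rv2)
  interpret U: prob_space "distr M S U" by (rule prob_space_distr) simp
  interpret V: prob_space "distr M N V" by (rule prob_space_distr) simp
  interpret UV: pair_prob_space "distr M S U" "distr M N V" ..
  have eq: "distr M S U \<Otimes>\<^sub>M distr M N V = distr M (S \<Otimes>\<^sub>M N) (\<lambda>\<omega>. (U \<omega>, V \<omega>))"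
    using indep by (simp add: indep_var_distribution_eq)
  have int': "integrable (distr M S U \<Otimes>\<^sub>M distr M N V) g"
    unfolding eq using int by (subst integrable_distr_eq) auto
  have "(\<integral>\<omega>. g (U \<omega>, V \<omega>) \<partial>M) = integral\<^sup>L (distr M S U \<Otimes>\<^sub>M distr M N V) g"
    unfolding eq by (subst integral_distr) auto
  also have "\<dots> = (\<integral>u. (\<integral>v. g (u, v) \<partial>distr M N V) \<partial>distr M S U)"
    by (rule UV.integral_fst'[symmetric, OF int'])
  also have "\<dots> = (\<integral>u. 0 \<partial>distr M S U)"
    using zero by (intro Bochner_Integration.integral_cong) (auto simp: integral_distr)
  finally show ?thesis by simp
qed

section \<open>Lipschitz coefficients and histories\<close>

lemma acoef_nonneg:
  assumes "\<And>i. i \<ge> 1 \<Longrightarrow> a i \<ge> 0"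
  shows "acoef a k \<ge> 0"
proof (induction k rule: less_induct)
  case (less k)
  show ?case
  proof (cases k)
    case (Suc m)
    have "acoef a l * a (Suc m - l) \<ge> 0" if "l \<in> {1..m}" for l
      using that less[of l] assms[of "Suc m - l"] Suc by (intro mult_nonneg_nonneg) auto
    then have "(\<Sum>l = 1..m. acoef a l * a (Suc m - l)) \<ge> 0"
      by (rule sum_nonneg)
    then show ?thesis
      using assms[of "Suc m"] Suc by simp
  qed simp
qed

text \<open>\<open>lipcoef a r j\<close> is the Lipschitz constant of \<open>E[f(X\<^sub>1, \<dots>, X\<^sub>n) | X\<^sub>1, \<dots>, X\<^bsub>n-r\<^esub>]\<close> in the
  variable \<open>X\<^bsub>n-r-j\<^esub>\<close>.\<close>

definition lipcoef :: "(nat \<Rightarrow> real) \<Rightarrow> nat \<Rightarrow> nat \<Rightarrow> real" where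
  "lipcoef a r j = 1 + (\<Sum>m<r. acoef a m * a (j + r - m))"

text \<open>When the newest variable is integrated out, its coefficient \<open>acoef a r\<close> is
  spread over the older variables with weights \<open>a (Suc j)\<close>, while their own
  coefficients shift by one place.\<close>

lemma lipcoef_Suc: "lipcoef a (Suc r) j = lipcoef a r (Suc j) + acoef a r * a (Suc j)"
  by (simp add: lipcoef_def)

text \<open>At \<open>j = 0\<close> the sum is the recursion for \<open>acoef\<close>; its term
  \<open>m = 0\<close> supplies the separate summand \<open>a r\<close>, as
  \<open>acoef a 0 = 1\<close>.\<close>

lemma lipcoef_zero: "lipcoef a r 0 = acoef a r"
proof (cases r)
  case (Suc k)
  have "(\<Sum>m<Suc k. acoef a m * a (Suc k - m))
      = a (Suc k) + (\<Sum>l = 1..k. acoef a l * a (Suc k - l))"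
    by (subst sum.lessThan_Suc_shift) (simp add: sum.atLeast1_atMost_eq del: acoef.simps(2))
  then show ?thesis by (simp only: Suc lipcoef_def acoef.simps add_0 add.assoc)
qed (simp add: lipcoef_def)

text \<open>Histories up to time \<open>k\<close> are stored backwards, \<open>h j = X\<^bsub>k-j\<^esub>\<close>, so that \<open>past X (Suc k) \<omega>\<close>
  is the history up to time \<open>k\<close>.\<close>

definition extend :: "(nat \<Rightarrow> (nat \<Rightarrow> 'x) \<Rightarrow> 'y \<Rightarrow> 'x) \<Rightarrow> nat \<Rightarrow> (nat \<Rightarrow> 'x) \<Rightarrow> 'y \<Rightarrow> (nat \<Rightarrow> 'x)" where
  "extend F k h y = case_nat (F k h y) h"

text \<open>Indices \<open>j\<close> from \<open>k\<close> on belong to times at most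
  \<open>0\<close>, where the values are deterministic. Two members therefore differ in at most
  \<open>k\<close> entries.\<close>

definition histories :: "(int \<Rightarrow> 'x) \<Rightarrow> nat \<Rightarrow> (nat \<Rightarrow> 'x) set" where
  "histories \<xi> k = {h. \<forall>j\<ge>k. h j = \<xi> (int k - int j)}"

lemma extend_simps [simp]: "extend F k h y 0 = F k h y" "extend F k h y (Suc j) = h j"
  by (simp_all add: extend_def)

lemma extend_in_histories:
  assumes "h \<in> histories \<xi> k"
  shows "extend F m h y \<in> histories \<xi> (Suc k)"
  using assms by (auto simp: histories_def extend_def split: nat.split)

primrec history :: "(nat \<Rightarrow> (nat \<Rightarrow> 'x) \<Rightarrow> 'y \<Rightarrow> 'x) \<Rightarrow> (int \<Rightarrow> 'x) \<Rightarrow> nat \<Rightarrow> (nat \<Rightarrow> 'y) \<Rightarrow> (nat \<Rightarrow> 'x)" where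
  "history F \<xi> 0 e = (\<lambda>j. \<xi> (- int j))"
| "history F \<xi> (Suc k) e = extend F (Suc k) (history F \<xi> k e) (e (Suc k))"

lemma history_in_histories: "history F \<xi> k e \<in> histories \<xi> k"
proof (induction k)
  case (Suc k)
  then show ?case by (simp add: extend_in_histories)
qed (simp add: histories_def)

lemma history_cong:
  assumes "\<And>i. 1 \<le> i \<Longrightarrow> i \<le> k \<Longrightarrow> e i = e' i"
  shows "history F \<xi> k e = history F \<xi> k e'"
  using assms by (induction k) auto

text \<open>This rewrites the process as an explicit function of the noise, which is what
  independence can be applied to.\<close>

lemma past_eq_history:
  assumes "\<And>i. i \<le> 0 \<Longrightarrow> X i \<omega> = \<xi> i"
    and "\<And>m. m \<ge> 1 \<Longrightarrow> X (int m) \<omega> = F m (past X m \<omega>) (\<epsilon> m \<omega>)"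
  shows "past X (Suc k) \<omega> = history F \<xi> k (\<lambda>i. \<epsilon> i \<omega>)"
proof (induction k)
  case 0
  then show ?case by (auto simp: past_def assms(1))
next
  case (Suc k)
  have "past X (Suc (Suc k)) \<omega> = extend F (Suc k) (past X (Suc k) \<omega>) (\<epsilon> (Suc k) \<omega>)"
  proof
    fix j
    show "past X (Suc (Suc k)) \<omega> j = extend F (Suc k) (past X (Suc k) \<omega>) (\<epsilon> (Suc k) \<omega>) j"
      using assms(2)[of "Suc k"] by (cases j) (simp_all add: past_def)
  qed
  then show ?case by (simp only: Suc history.simps)
qed

text \<open>The deterministic tails coincide, so the contraction bound becomes a finite real
  sum.\<close>

lemma suminf_dist_histories:
  assumes "h \<in> histories \<xi> k" "h' \<in> histories \<xi> k" "\<And>i. i \<ge> 1 \<Longrightarrow> a i \<ge> 0"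
  shows "(\<Sum>j. ennreal (a (Suc j) * dist (h j) (h' j)))
    = ennreal (\<Sum>j<k. a (Suc j) * dist (h j) (h' j))"
proof -
  have "(\<Sum>j. ennreal (a (Suc j) * dist (h j) (h' j)))
      = (\<Sum>j<k. ennreal (a (Suc j) * dist (h j) (h' j)))"
    using assms by (intro suminf_finite) (auto simp: histories_def)
  also have "\<dots> = ennreal (\<Sum>j<k. a (Suc j) * dist (h j) (h' j))"
    using assms by (intro sum_ennreal) auto
  finally show ?thesis .
qed

text \<open>\<open>P m\<close> is the law of \<open>\<epsilon>\<^sub>m\<close>.\<close>

locale contractive_recursion =
  fixes F :: "nat \<Rightarrow> (nat \<Rightarrow> 'x::polish_space) \<Rightarrow> 'y::polish_space \<Rightarrow> 'x"
    and P :: "nat \<Rightarrow> 'y measure"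
    and \<xi> :: "int \<Rightarrow> 'x"
    and a :: "nat \<Rightarrow> real"
    and n :: nat
    and f :: "(nat \<Rightarrow> 'x) \<Rightarrow> real"
  assumes prob_P: "\<And>m. m \<ge> 1 \<Longrightarrow> prob_space (P m)"
    and sets_P: "\<And>m. m \<ge> 1 \<Longrightarrow> sets (P m) = sets borel"
    and measurable_F: "\<And>m. m \<ge> 1 \<Longrightarrow>
      (\<lambda>(x, y). F m x y) \<in> (\<Pi>\<^sub>M i\<in>UNIV. borel) \<Otimes>\<^sub>M borel \<rightarrow>\<^sub>M borel"
    and a_nonneg: "\<And>i. i \<ge> 1 \<Longrightarrow> a i \<ge> 0"
    and contraction: "\<And>m x x'. m \<ge> 1 \<Longrightarrow>
      (\<integral>\<^sup>+ y. ennreal (dist (F m x y) (F m x' y)) \<partial>P m)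
        \<le> (\<Sum>j. ennreal (a (Suc j) * dist (x j) (x' j)))"
    and f_lipschitz: "\<And>x x'. \<bar>f x - f x'\<bar> \<le> (\<Sum>i = 1..n. dist (x i) (x' i))"
    and H_finite_somewhere: "\<And>k. k < n \<Longrightarrow> \<exists>h\<in>histories \<xi> k. \<exists>e. H F (P (Suc k)) (Suc k) h e < \<infinity>"
begin

section \<open>Measurability, finiteness and Lipschitz bounds along histories\<close>

lemma measurable_F' [measurable (raw)]:
  assumes "m \<ge> 1" "g \<in> N \<rightarrow>\<^sub>M (\<Pi>\<^sub>M i\<in>UNIV. borel)" "g' \<in> N \<rightarrow>\<^sub>M borel"
  shows "(\<lambda>x. F m (g x) (g' x)) \<in> N \<rightarrow>\<^sub>M borel"
  using measurable_compose[OF measurable_Pair[OF assms(2,3)] measurable_F[OF assms(1)]] by simp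

lemma measurable_extend [measurable (raw)]:
  assumes "m \<ge> 1" "g \<in> N \<rightarrow>\<^sub>M (\<Pi>\<^sub>M i\<in>UNIV. borel)" "g' \<in> N \<rightarrow>\<^sub>M borel"
  shows "(\<lambda>x. extend F m (g x) (g' x)) \<in> N \<rightarrow>\<^sub>M (\<Pi>\<^sub>M i\<in>UNIV. borel)"
  unfolding extend_def by (rule measurable_case_nat'[OF measurable_F'[OF assms] assms(2)])

lemma measurable_history:
  assumes "k \<le> K"
  shows "history F \<xi> k \<in> (\<Pi>\<^sub>M i\<in>{1..K}. borel) \<rightarrow>\<^sub>M (\<Pi>\<^sub>M i\<in>UNIV. borel)"
  using assms
proof (induction k)
  case 0
  have "history F \<xi> 0 = (\<lambda>e j. \<xi> (- int j))" by (simp add: fun_eq_iff)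
  then show ?case
    by (simp add: measurable_const space_PiM)
next
  case (Suc k)
  have "(\<lambda>e. extend F (Suc k) (history F \<xi> k e) (e (Suc k)))
      \<in> (\<Pi>\<^sub>M i\<in>{1..K}. borel) \<rightarrow>\<^sub>M (\<Pi>\<^sub>M i\<in>UNIV. borel)"
    using Suc by (intro measurable_extend measurable_component_singleton) auto
  then show ?case by (simp add: fun_eq_iff)
qed

text \<open>Finiteness at one pair \<open>h0\<close>, \<open>e0\<close> spreads to all others by the
  triangle inequality: the change of noise value costs a constant, and the change of history costs a
  finite amount by the contraction.\<close>

lemma H_finite:
  assumes "k < n" "h \<in> histories \<xi> k"
  shows "H F (P (Suc k)) (Suc k) h e < \<infinity>"
proof -
  interpret prob_space "P (Suc k)" by (rule prob_P) simp
  note [measurable_cong] = sets_P[of "Suc k", simplified]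
  let ?F = "F (Suc k)"
  have [measurable]: "?F g \<in> borel_measurable borel" for g
    using measurable_F'[of "Suc k" "\<lambda>_. g" borel "\<lambda>y. y"] by (simp add: space_PiM)
  obtain h0 e0 where h0: "h0 \<in> histories \<xi> k" and H0: "H F (P (Suc k)) (Suc k) h0 e0 < \<infinity>"
    using H_finite_somewhere[OF assms(1)] by auto
  have "H F (P (Suc k)) (Suc k) h e
      \<le> (\<integral>\<^sup>+ y. ennreal (dist (?F h e) (?F h0 e0)) + ennreal (dist (?F h0 e0) (?F h0 y))
          + ennreal (dist (?F h0 y) (?F h y)) \<partial>P (Suc k))"
    unfolding H_def
  proof (rule nn_integral_mono)
    fix y
    have "dist (?F h e) (?F h y)
        \<le> dist (?F h e) (?F h0 e0) + dist (?F h0 e0) (?F h0 y) + dist (?F h0 y) (?F h y)"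
      using dist_triangle[of "?F h e" "?F h y" "?F h0 y"]
        dist_triangle[of "?F h e" "?F h0 y" "?F h0 e0"] by linarith
    then show "ennreal (dist (?F h e) (?F h y)) \<le> ennreal (dist (?F h e) (?F h0 e0))
        + ennreal (dist (?F h0 e0) (?F h0 y)) + ennreal (dist (?F h0 y) (?F h y))"
      by (simp flip: ennreal_plus)
  qed
  also have "\<dots> = ennreal (dist (?F h e) (?F h0 e0)) + H F (P (Suc k)) (Suc k) h0 e0
      + (\<integral>\<^sup>+ y. ennreal (dist (?F h0 y) (?F h y)) \<partial>P (Suc k))"
    unfolding H_def
    by (subst nn_integral_add; (subst nn_integral_add)?) (auto simp: emeasure_space_1)
  also have "\<dots> < \<infinity>"
  proof -
    have "(\<integral>\<^sup>+ y. ennreal (dist (?F h0 y) (?F h y)) \<partial>P (Suc k))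
        \<le> (\<Sum>j. ennreal (a (Suc j) * dist (h0 j) (h j)))"
      by (rule contraction) simp
    also have "\<dots> < \<infinity>"
      using suminf_dist_histories[where a = a, OF h0 assms(2) a_nonneg] by simp
    finally show ?thesis using H0 by simp
  qed
  finally show ?thesis .
qed

text \<open>\<open>proj r h\<close> is the conditional expectation of \<open>f (X\<^sub>1, \<dots>, X\<^sub>n)\<close> given the history \<open>h\<close> up to
  time \<open>n - r\<close>.\<close>

primrec proj :: "nat \<Rightarrow> (nat \<Rightarrow> 'x) \<Rightarrow> real" where
  "proj 0 h = f (\<lambda>i. h (n - i))"
| "proj (Suc r) h = (\<integral>y. proj r (extend F (n - r) h y) \<partial>P (n - r))"

lemma measurable_proj:
  assumes "r \<le> n"
  shows "proj r \<in> borel_measurable (\<Pi>\<^sub>M i\<in>UNIV. borel)"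
  using assms
proof (induction r)
  case 0
  have [measurable]: "f \<in> borel_measurable (\<Pi>\<^sub>M i\<in>UNIV. borel)"
    using f_lipschitz by (rule measurable_sum_dist_lipschitz)
  have [measurable]: "(\<lambda>(h :: nat \<Rightarrow> 'x) i. h (n - i)) \<in> (\<Pi>\<^sub>M i\<in>UNIV. borel) \<rightarrow>\<^sub>M (\<Pi>\<^sub>M i\<in>UNIV. borel)"
    by (intro measurable_PiM_single' measurable_component_singleton) (auto simp: space_PiM)
  have "(\<lambda>h. f (\<lambda>i. h (n - i))) \<in> borel_measurable (\<Pi>\<^sub>M i\<in>UNIV. borel)"
    by measurable
  then show ?case by (simp add: fun_eq_iff)
next
  case (Suc r)
  then have [measurable]: "proj r \<in> borel_measurable (\<Pi>\<^sub>M i\<in>UNIV. borel)" and nr: "n - r \<ge> 1"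
    by auto
  interpret prob_space "P (n - r)" by (rule prob_P[OF nr])
  note [measurable_cong] = sets_P[OF nr]
  have "(\<lambda>h. \<integral>y. proj r (extend F (n - r) h y) \<partial>P (n - r)) \<in> borel_measurable (\<Pi>\<^sub>M i\<in>UNIV. borel)"
    using nr by measurable
  then show ?case by (simp add: fun_eq_iff)
qed

lemma integrable_dist_F:
  assumes "k < n" "h \<in> histories \<xi> k"
  shows "integrable (P (Suc k)) (\<lambda>y. dist (F (Suc k) h e) (F (Suc k) h y))"
    and "ennreal (\<integral>y. dist (F (Suc k) h e) (F (Suc k) h y) \<partial>P (Suc k)) = H F (P (Suc k)) (Suc k) h e"
proof -
  note [measurable_cong] = sets_P[of "Suc k", simplified]
  have [measurable]: "F (Suc k) h \<in> borel_measurable borel"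
    using measurable_F'[of "Suc k" "\<lambda>_. h" borel "\<lambda>y. y"] by (simp add: space_PiM)
  show *: "integrable (P (Suc k)) (\<lambda>y. dist (F (Suc k) h e) (F (Suc k) h y))"
    using H_finite[OF assms, of e] by (intro integrableI_bounded) (auto simp: H_def)
  show "ennreal (\<integral>y. dist (F (Suc k) h e) (F (Suc k) h y) \<partial>P (Suc k)) = H F (P (Suc k)) (Suc k) h e"
    unfolding H_def by (rule nn_integral_eq_integral[symmetric, OF *]) auto
qed

text \<open>Two extensions of one history differ only at index \<open>0\<close>, whose coefficient
  is \<open>acoef a r\<close>. The Lipschitz bound is a hypothesis because the lemma serves inside
  the induction that proves it.\<close>

lemma integrable_proj_extend:
  assumes r: "r < n" and h: "h \<in> histories \<xi> (n - Suc r)"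
    and lip: "\<And>h h'. h \<in> histories \<xi> (n - r) \<Longrightarrow> h' \<in> histories \<xi> (n - r) \<Longrightarrow>
      \<bar>proj r h - proj r h'\<bar> \<le> (\<Sum>j<n - r. lipcoef a r j * dist (h j) (h' j))"
  shows "integrable (P (n - r)) (\<lambda>y. proj r (extend F (n - r) h y))"
    and "\<bar>proj r (extend F (n - r) h e) - proj r (extend F (n - r) h y)\<bar>
      \<le> acoef a r * dist (F (n - r) h e) (F (n - r) h y)"
proof -
  define k where "k = n - Suc r"
  have k: "n - r = Suc k" "k < n" using r by (auto simp: k_def)
  interpret prob_space "P (Suc k)" by (rule prob_P) simp
  note [measurable_cong] = sets_P[of "Suc k", simplified]
  have [measurable]: "proj r \<in> borel_measurable (\<Pi>\<^sub>M i\<in>UNIV. borel)"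
    using r by (intro measurable_proj) auto
  have h': "h \<in> histories \<xi> k" using h by (simp add: k_def)
  have bound: "\<bar>proj r (extend F (Suc k) h e) - proj r (extend F (Suc k) h y)\<bar>
      \<le> acoef a r * dist (F (Suc k) h e) (F (Suc k) h y)" for e y
  proof -
    have "\<bar>proj r (extend F (Suc k) h e) - proj r (extend F (Suc k) h y)\<bar>
        \<le> (\<Sum>j<Suc k. lipcoef a r j * dist (extend F (Suc k) h e j) (extend F (Suc k) h y j))"
      by (rule lip[unfolded k(1), OF extend_in_histories[OF h'] extend_in_histories[OF h']])
    also have "\<dots> = acoef a r * dist (F (Suc k) h e) (F (Suc k) h y)"
      by (subst sum.lessThan_Suc_shift) (simp add: lipcoef_zero)
    finally show ?thesis .
  qed
  then show "\<bar>proj r (extend F (n - r) h e) - proj r (extend F (n - r) h y)\<bar>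
      \<le> acoef a r * dist (F (n - r) h e) (F (n - r) h y)"
    by (simp add: k)
  have "integrable (P (Suc k)) (\<lambda>y. proj r (extend F (Suc k) h y))"
  proof (rule Bochner_Integration.integrable_bound)
    \<comment> \<open>\<open>undefined\<close> is an arbitrary fixed noise value that serves as
      reference point.\<close>
    show "integrable (P (Suc k)) (\<lambda>y. \<bar>proj r (extend F (Suc k) h undefined)\<bar>
        + acoef a r * dist (F (Suc k) h undefined) (F (Suc k) h y))"
      using integrable_dist_F(1)[OF k(2) h'] by auto
    show "(\<lambda>y. proj r (extend F (Suc k) h y)) \<in> borel_measurable (P (Suc k))"
      by measurable (auto simp: space_PiM)
    show "AE y in P (Suc k). norm (proj r (extend F (Suc k) h y))
        \<le> norm (\<bar>proj r (extend F (Suc k) h undefined)\<bar>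
        + acoef a r * dist (F (Suc k) h undefined) (F (Suc k) h y))"
    proof (rule AE_I2)
      fix y
      show "norm (proj r (extend F (Suc k) h y)) \<le> norm (\<bar>proj r (extend F (Suc k) h undefined)\<bar>
          + acoef a r * dist (F (Suc k) h undefined) (F (Suc k) h y))"
        using bound[of undefined y] unfolding real_norm_def by arith
    qed
  qed
  then show "integrable (P (n - r)) (\<lambda>y. proj r (extend F (n - r) h y))"
    by (simp add: k)
qed

text \<open>Induction on the number of variables integrated out. The distance of the newest entries
  is averaged over the noise and bounded by the contraction; the coefficients then combine by
  \<open>lipcoef_Suc\<close>.\<close>

lemma proj_lipschitz:
  assumes "r \<le> n" "h \<in> histories \<xi> (n - r)" "h' \<in> histories \<xi> (n - r)"
  shows "\<bar>proj r h - proj r h'\<bar> \<le> (\<Sum>j<n - r. lipcoef a r j * dist (h j) (h' j))"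
  using assms
proof (induction r arbitrary: h h')
  case 0
  have "\<bar>proj 0 h - proj 0 h'\<bar> \<le> (\<Sum>i = 1..n. dist (h (n - i)) (h' (n - i)))"
    using f_lipschitz[of "\<lambda>i. h (n - i)" "\<lambda>i. h' (n - i)"] by simp
  also have "\<dots> = (\<Sum>i<n. dist (h (n - Suc i)) (h' (n - Suc i)))"
    by (simp add: sum.atLeast1_atMost_eq)
  also have "\<dots> = (\<Sum>j<n. dist (h j) (h' j))"
    by (rule sum.nat_diff_reindex)
  finally show ?case by (simp add: lipcoef_def)
next
  case (Suc r)
  define k where "k = n - Suc r"
  have k: "n - r = Suc k" "k < n" using Suc.prems by (auto simp: k_def)
  interpret prob_space "P (Suc k)" by (rule prob_P) simp
  note [measurable_cong] = sets_P[of "Suc k", simplified]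
  have [measurable]: "F (Suc k) g \<in> borel_measurable borel" for g
    using measurable_F'[of "Suc k" "\<lambda>_. g" borel "\<lambda>y. y"] by (simp add: space_PiM)
  have hk: "h \<in> histories \<xi> k" "h' \<in> histories \<xi> k"
    using Suc.prems by (auto simp: k_def)
  have IH: "\<bar>proj r g - proj r g'\<bar> \<le> (\<Sum>j<n - r. lipcoef a r j * dist (g j) (g' j))"
    if "g \<in> histories \<xi> (n - r)" "g' \<in> histories \<xi> (n - r)" for g g'
    using Suc.IH Suc.prems that by auto
  have int: "integrable (P (Suc k)) (\<lambda>y. proj r (extend F (Suc k) g y))"
    if "g \<in> histories \<xi> k" for g
    using integrable_proj_extend(1)[OF _ _ IH, of g] that Suc.prems k by (simp add: k_def)
  let ?S = "\<Sum>j<k. a (Suc j) * dist (h j) (h' j)"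
  have nn: "(\<integral>\<^sup>+ y. ennreal (dist (F (Suc k) h y) (F (Suc k) h' y)) \<partial>P (Suc k)) \<le> ennreal ?S"
    using contraction[of "Suc k" h h'] suminf_dist_histories[where a = a, OF hk a_nonneg] by simp
  have int_d: "integrable (P (Suc k)) (\<lambda>y. dist (F (Suc k) h y) (F (Suc k) h' y))"
    using nn by (intro integrableI_bounded) (auto intro: le_less_trans)
  have S: "?S \<ge> 0" using a_nonneg by (intro sum_nonneg) auto
  have d_le: "(\<integral>y. dist (F (Suc k) h y) (F (Suc k) h' y) \<partial>P (Suc k)) \<le> ?S"
    using nn S nn_integral_eq_integral[OF int_d] by (simp add: ennreal_le_iff)
  have "\<bar>proj (Suc r) h - proj (Suc r) h'\<bar>
      = \<bar>\<integral>y. proj r (extend F (Suc k) h y) - proj r (extend F (Suc k) h' y) \<partial>P (Suc k)\<bar>"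
    using int hk by (simp add: k)
  also have "\<dots> \<le> (\<integral>y. \<bar>proj r (extend F (Suc k) h y) - proj r (extend F (Suc k) h' y)\<bar> \<partial>P (Suc k))"
    by (rule integral_abs_bound)
  also have "\<dots> \<le> (\<integral>y. acoef a r * dist (F (Suc k) h y) (F (Suc k) h' y)
      + (\<Sum>j<k. lipcoef a r (Suc j) * dist (h j) (h' j)) \<partial>P (Suc k))"
  proof (intro integral_mono)
    fix y
    have "\<bar>proj r (extend F (Suc k) h y) - proj r (extend F (Suc k) h' y)\<bar>
        \<le> (\<Sum>j<Suc k. lipcoef a r j * dist (extend F (Suc k) h y j) (extend F (Suc k) h' y j))"
      by (rule IH[unfolded k(1), OF extend_in_histories[OF hk(1)] extend_in_histories[OF hk(2)]])
    also have "\<dots> = acoef a r * dist (F (Suc k) h y) (F (Suc k) h' y)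
        + (\<Sum>j<k. lipcoef a r (Suc j) * dist (h j) (h' j))"
      by (subst sum.lessThan_Suc_shift) (simp add: lipcoef_zero)
    finally show "\<bar>proj r (extend F (Suc k) h y) - proj r (extend F (Suc k) h' y)\<bar>
        \<le> acoef a r * dist (F (Suc k) h y) (F (Suc k) h' y)
        + (\<Sum>j<k. lipcoef a r (Suc j) * dist (h j) (h' j))" .
  qed (use int hk int_d in auto)
  also have "\<dots> = acoef a r * (\<integral>y. dist (F (Suc k) h y) (F (Suc k) h' y) \<partial>P (Suc k))
      + (\<Sum>j<k. lipcoef a r (Suc j) * dist (h j) (h' j))"
    using int_d by (simp add: prob_space)
  also have "\<dots> \<le> acoef a r * ?S + (\<Sum>j<k. lipcoef a r (Suc j) * dist (h j) (h' j))"
    using d_le acoef_nonneg[of a, OF a_nonneg] by (intro add_right_mono mult_left_mono) auto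
  also have "\<dots> = (\<Sum>j<k. lipcoef a (Suc r) j * dist (h j) (h' j))"
    by (simp add: lipcoef_Suc algebra_simps sum.distrib sum_distrib_left)
  finally show ?case by (simp add: k_def)
qed

text \<open>\<open>proj (n - k) h\<close> is the mean of the extended values over an independent
  noise copy \<open>y\<close>. Comparing with each copy costs the distance of the new entries, and
  averaging these distances produces \<open>H\<close>.\<close>

lemma abs_proj_extend_diff_le_H:
  assumes "k < n" "h \<in> histories \<xi> k"
  shows "ennreal \<bar>proj (n - Suc k) (extend F (Suc k) h e) - proj (n - k) h\<bar>
    \<le> ennreal (acoef a (n - Suc k)) * H F (P (Suc k)) (Suc k) h e"
proof -
  define r where "r = n - Suc k"
  have r: "n - r = Suc k" "n - k = Suc r" "n - Suc r = k" "r < n"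
    using assms by (auto simp: r_def)
  interpret prob_space "P (Suc k)" by (rule prob_P) simp
  note ext = integrable_proj_extend[of r h, unfolded r, OF \<open>r < n\<close> assms(2)
      proj_lipschitz[of r, unfolded r, OF less_imp_le[OF \<open>r < n\<close>]], simplified]
  note int = ext(1)
  have "\<bar>proj r (extend F (Suc k) h e) - proj (Suc r) h\<bar>
      = \<bar>\<integral>y. proj r (extend F (Suc k) h e) - proj r (extend F (Suc k) h y) \<partial>P (Suc k)\<bar>"
    using int by (simp add: r prob_space)
  also have "\<dots> \<le> (\<integral>y. \<bar>proj r (extend F (Suc k) h e) - proj r (extend F (Suc k) h y)\<bar> \<partial>P (Suc k))"
    by (rule integral_abs_bound)
  also have "\<dots> \<le> (\<integral>y. acoef a r * dist (F (Suc k) h e) (F (Suc k) h y) \<partial>P (Suc k))"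
    using int integrable_dist_F(1)[OF assms] by (intro integral_mono ext(2)) auto
  also have "\<dots> = acoef a r * (\<integral>y. dist (F (Suc k) h e) (F (Suc k) h y) \<partial>P (Suc k))"
    by simp
  finally have "ennreal \<bar>proj r (extend F (Suc k) h e) - proj (Suc r) h\<bar>
      \<le> ennreal (acoef a r * (\<integral>y. dist (F (Suc k) h e) (F (Suc k) h y) \<partial>P (Suc k)))"
    by (rule ennreal_leI)
  also have "\<dots> = ennreal (acoef a r) * H F (P (Suc k)) (Suc k) h e"
    using acoef_nonneg[of a, OF a_nonneg] by (simp add: ennreal_mult' integrable_dist_F(2)[OF assms])
  finally show ?thesis by (simp add: r_def[symmetric] r)
qed

lemma integral_proj_extend_diff:
  assumes "k < n" "h \<in> histories \<xi> k"
  shows "(\<integral>y. proj (n - Suc k) (extend F (Suc k) h y) - proj (n - k) h \<partial>P (Suc k)) = 0"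
proof -
  define r where "r = n - Suc k"
  have r: "n - r = Suc k" "n - k = Suc r" "n - Suc r = k" "r < n"
    using assms by (auto simp: r_def)
  interpret prob_space "P (Suc k)" by (rule prob_P) simp
  note ext = integrable_proj_extend(1)[of r h, unfolded r, OF \<open>r < n\<close> assms(2)
      proj_lipschitz[of r, unfolded r, OF less_imp_le[OF \<open>r < n\<close>]], simplified]
  show ?thesis
    using ext by (simp add: r_def[symmetric] r prob_space)
qed

end

section \<open>The Doob martingale\<close>

lemma measurable_epowr: "(\<lambda>x. epowr x p) \<in> borel_measurable borel"
  unfolding epowr_def by measurable

locale driven_recursion = contractive_recursion F P \<xi> a n f + prob_space M
  for F :: "nat \<Rightarrow> (nat \<Rightarrow> 'x::polish_space) \<Rightarrow> 'y::polish_space \<Rightarrow> 'x"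
    and P \<xi> a n f
    and M :: "'w measure" +
  fixes \<epsilon> :: "nat \<Rightarrow> 'w \<Rightarrow> 'y"
  assumes indep_\<epsilon>: "indep_vars (\<lambda>_. borel) \<epsilon> {1..}"
    and law_\<epsilon>: "\<And>k. k \<ge> 1 \<Longrightarrow> P k = distr M borel (\<epsilon> k)"
begin

text \<open>The Doob martingale of \<open>f\<close> at time \<open>k\<close> for \<open>k\<close> at
  most \<open>n\<close>, given explicitly as a function of the noise; \<open>proj\<close> counts the
  remaining \<open>n - k\<close> variables.\<close>

definition doob :: "nat \<Rightarrow> 'w \<Rightarrow> real" where
  "doob k \<omega> = proj (n - k) (history F \<xi> k (\<lambda>i. \<epsilon> i \<omega>))"

lemma measurable_\<epsilon>: "k \<ge> 1 \<Longrightarrow> \<epsilon> k \<in> borel_measurable M"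
  using indep_\<epsilon> by (auto simp: indep_vars_def)

lemma doob_0: "doob 0 \<omega> = doob 0 \<omega>'"
  by (simp add: doob_def)

lemma doob_Suc: "doob (Suc k) \<omega>
    = proj (n - Suc k) (extend F (Suc k) (history F \<xi> k (\<lambda>i. \<epsilon> i \<omega>)) (\<epsilon> (Suc k) \<omega>))"
  by (simp add: doob_def)

lemma measurable_history_\<epsilon>:
  "(\<lambda>\<omega>. history F \<xi> k (\<lambda>i. \<epsilon> i \<omega>)) \<in> M \<rightarrow>\<^sub>M (\<Pi>\<^sub>M i\<in>UNIV. borel)"
proof -
  have eq: "(\<lambda>\<omega>. history F \<xi> k (\<lambda>i. \<epsilon> i \<omega>)) = (\<lambda>\<omega>. history F \<xi> k (\<lambda>i\<in>{1..k}. \<epsilon> i \<omega>))"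
    by (intro ext history_cong) auto
  have "(\<lambda>\<omega>. \<lambda>i\<in>{1..k}. \<epsilon> i \<omega>) \<in> M \<rightarrow>\<^sub>M (\<Pi>\<^sub>M i\<in>{1..k}. borel)"
    using measurable_\<epsilon> by (intro measurable_restrict) auto
  from measurable_compose[OF this measurable_history[OF order_refl]]
  show ?thesis unfolding eq .
qed

lemma measurable_doob: "doob k \<in> borel_measurable M"
  using measurable_compose[OF measurable_history_\<epsilon> measurable_proj[OF diff_le_self]]
  unfolding doob_def .

text \<open>Given the first \<open>k\<close> noises the increment has mean zero, and
  \<open>w (doob k \<omega>)\<close> is then a constant factor. The weight \<open>1\<close> yields
  centring, a signed power yields the orthogonality in Rio's inequality.\<close>

lemma integral_doob_increment:
  assumes k: "k < n" and [measurable]: "w \<in> borel_measurable borel"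
    and int: "integrable M (\<lambda>\<omega>. w (doob k \<omega>) * (doob (Suc k) \<omega> - doob k \<omega>))"
  shows "(\<integral>\<omega>. w (doob k \<omega>) * (doob (Suc k) \<omega> - doob k \<omega>) \<partial>M) = 0"
proof -
  let ?S = "\<Pi>\<^sub>M i\<in>{1..k}. borel :: 'y measure"
  let ?N = "\<Pi>\<^sub>M i\<in>{Suc k}. borel :: 'y measure"
  define U where "U = (\<lambda>\<omega>. \<lambda>i\<in>{1..k}. \<epsilon> i \<omega>)"
  \<comment> \<open>The single noise is kept as a one-entry family, since independence is obtained
    for restrictions to disjoint index sets.\<close>
  define V where "V = (\<lambda>\<omega>. \<lambda>i\<in>{Suc k}. \<epsilon> i \<omega>)"
  have indep: "indep_var ?S U ?N V"
    unfolding U_def V_def by (rule indep_var_restrict[OF indep_\<epsilon>]) auto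
  have [measurable]: "proj (n - k) \<in> borel_measurable (\<Pi>\<^sub>M i\<in>UNIV. borel)"
    "proj (n - Suc k) \<in> borel_measurable (\<Pi>\<^sub>M i\<in>UNIV. borel)"
    by (auto intro: measurable_proj)
  have [measurable]: "history F \<xi> k \<in> ?S \<rightarrow>\<^sub>M (\<Pi>\<^sub>M i\<in>UNIV. borel)"
    by (rule measurable_history) simp
  have [measurable]: "\<epsilon> (Suc k) \<in> borel_measurable M"
    by (rule measurable_\<epsilon>) simp
  define g where "g = (\<lambda>(u, v). w (proj (n - k) (history F \<xi> k u))
      * (proj (n - Suc k) (extend F (Suc k) (history F \<xi> k u) (v (Suc k))) - proj (n - k) (history F \<xi> k u)))"
  have [measurable]: "(\<lambda>(u, v). extend F (Suc k) (history F \<xi> k u) (v (Suc k))) \<in> ?S \<Otimes>\<^sub>M ?N \<rightarrow>\<^sub>M (\<Pi>\<^sub>M i\<in>UNIV. borel)"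
    unfolding case_prod_beta by (rule measurable_extend) measurable
  have g [measurable]: "g \<in> borel_measurable (?S \<Otimes>\<^sub>M ?N)"
    unfolding g_def by measurable
  have U: "history F \<xi> k (U \<omega>) = history F \<xi> k (\<lambda>i. \<epsilon> i \<omega>)" for \<omega>
    by (rule history_cong) (simp add: U_def)
  have g_UV: "g (U \<omega>, V \<omega>) = w (doob k \<omega>) * (doob (Suc k) \<omega> - doob k \<omega>)" for \<omega>
    by (simp add: g_def U doob_Suc) (simp add: doob_def V_def)
  have "(\<integral>\<omega>. g (U \<omega>, V \<omega>) \<partial>M) = 0"
  proof (rule integral_indep_conditional_zero[OF indep g])
    show "integrable M (\<lambda>\<omega>. g (U \<omega>, V \<omega>))"
      using int by (simp add: g_UV)
    fix u assume u: "u \<in> space ?S"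
    define h where "h = history F \<xi> k u"
    have [measurable]: "(\<lambda>y. extend F (Suc k) h y) \<in> borel \<rightarrow>\<^sub>M (\<Pi>\<^sub>M i\<in>UNIV. borel)"
      by (rule measurable_extend) (auto simp: space_PiM)
    have "(\<integral>\<omega>. g (u, V \<omega>) \<partial>M) = w (proj (n - k) h)
        * (\<integral>\<omega>. proj (n - Suc k) (extend F (Suc k) h (\<epsilon> (Suc k) \<omega>)) - proj (n - k) h \<partial>M)"
      by (simp add: g_def V_def h_def)
    also have "(\<integral>\<omega>. proj (n - Suc k) (extend F (Suc k) h (\<epsilon> (Suc k) \<omega>)) - proj (n - k) h \<partial>M)
        = (\<integral>y. proj (n - Suc k) (extend F (Suc k) h y) - proj (n - k) h \<partial>P (Suc k))"
      unfolding law_\<epsilon>[of "Suc k", simplified] by (subst integral_distr) auto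
    also have "\<dots> = 0"
      unfolding h_def by (rule integral_proj_extend_diff[OF k history_in_histories])
    finally show "(\<integral>\<omega>. g (u, V \<omega>) \<partial>M) = 0" by simp
  qed
  then show ?thesis by (simp add: g_UV)
qed

text \<open>The pointwise bound by \<open>acoef a (n - Suc k)\<close> times \<open>H\<close> is
  raised to the power \<open>p\<close> and integrated.\<close>

lemma doob_increment_moment:
  assumes k: "k < n" and p: "p > 0" and A: "A \<ge> 0"
    and moment: "(\<integral>\<^sup>+ \<omega>. epowr (H F (P (Suc k)) (Suc k) (history F \<xi> k (\<lambda>i. \<epsilon> i \<omega>)) (\<epsilon> (Suc k) \<omega>)) p \<partial>M)
      \<le> ennreal A"
  shows "integrable M (\<lambda>\<omega>. \<bar>doob (Suc k) \<omega> - doob k \<omega>\<bar> powr p)"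
    and "sqnorm M p (\<lambda>\<omega>. doob (Suc k) \<omega> - doob k \<omega>) \<le> (acoef a (n - Suc k))\<^sup>2 * A powr (2 / p)"
proof -
  define c where "c = acoef a (n - Suc k)"
  have c: "c \<ge> 0" unfolding c_def by (rule acoef_nonneg[of a, OF a_nonneg])
  define L where "L = (\<lambda>\<omega>. H F (P (Suc k)) (Suc k) (history F \<xi> k (\<lambda>i. \<epsilon> i \<omega>)) (\<epsilon> (Suc k) \<omega>))"
  have [measurable]: "doob k \<in> borel_measurable M" "doob (Suc k) \<in> borel_measurable M"
    by (rule measurable_doob)+
  have pw: "ennreal (\<bar>doob (Suc k) \<omega> - doob k \<omega>\<bar> powr p) \<le> ennreal (c powr p) * epowr (L \<omega>) p" for \<omega>
  proof -
    \<comment> \<open>Finiteness at every point makes \<open>enn2real\<close> faithful and selects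
      the real branch of \<open>epowr\<close>.\<close>
    have fin: "L \<omega> < \<infinity>"
      unfolding L_def by (rule H_finite[OF k history_in_histories])
    have "ennreal \<bar>doob (Suc k) \<omega> - doob k \<omega>\<bar> \<le> ennreal c * L \<omega>"
      using abs_proj_extend_diff_le_H[OF k history_in_histories]
      unfolding c_def L_def doob_Suc unfolding doob_def .
    also have "\<dots> = ennreal (c * enn2real (L \<omega>))"
      using fin c by (simp add: ennreal_mult')
    finally have "\<bar>doob (Suc k) \<omega> - doob k \<omega>\<bar> \<le> c * enn2real (L \<omega>)"
      using c by (subst (asm) ennreal_le_iff) auto
    then have "\<bar>doob (Suc k) \<omega> - doob k \<omega>\<bar> powr p \<le> (c * enn2real (L \<omega>)) powr p"
      using p by (intro powr_mono2) auto
    also have "\<dots> = c powr p * enn2real (L \<omega>) powr p"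
      using c by (simp add: powr_mult)
    finally show ?thesis
      using fin by (simp add: epowr_def ennreal_leI flip: ennreal_mult')
  qed
  have "(\<integral>\<^sup>+ \<omega>. ennreal (\<bar>doob (Suc k) \<omega> - doob k \<omega>\<bar> powr p) \<partial>M)
      \<le> (\<integral>\<^sup>+ \<omega>. ennreal (c powr p) * epowr (L \<omega>) p \<partial>M)"
    by (intro nn_integral_mono pw)
  also have "\<dots> \<le> ennreal (c powr p) * ennreal A"
  proof -
    have "(\<lambda>\<omega>. epowr (L \<omega>) p) \<in> borel_measurable M"
    proof (rule measurable_compose[OF _ measurable_epowr])
      have [measurable]: "\<epsilon> (Suc k) \<in> borel_measurable M"
        "(\<lambda>\<omega>. history F \<xi> k (\<lambda>i. \<epsilon> i \<omega>)) \<in> M \<rightarrow>\<^sub>M (\<Pi>\<^sub>M i\<in>UNIV. borel)"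
        by (simp_all add: measurable_\<epsilon> measurable_history_\<epsilon>)
      interpret Pk: prob_space "P (Suc k)" by (rule prob_P) simp
      note [measurable_cong] = sets_P[of "Suc k", simplified]
      show "L \<in> borel_measurable M"
        unfolding L_def H_def by measurable
    qed
    then show ?thesis
      using moment by (simp add: nn_integral_cmult L_def mult_left_mono)
  qed
  also have "\<dots> = ennreal (c powr p * A)"
    using A by (simp add: ennreal_mult')
  finally have nn: "(\<integral>\<^sup>+ \<omega>. ennreal (\<bar>doob (Suc k) \<omega> - doob k \<omega>\<bar> powr p) \<partial>M) \<le> ennreal (c powr p * A)" .
  show int: "integrable M (\<lambda>\<omega>. \<bar>doob (Suc k) \<omega> - doob k \<omega>\<bar> powr p)"
    using nn by (intro integrableI_bounded) (auto intro: le_less_trans)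
  have "(\<integral>\<omega>. \<bar>doob (Suc k) \<omega> - doob k \<omega>\<bar> powr p \<partial>M) \<le> c powr p * A"
    using nn A nn_integral_eq_integral[OF int] by (simp add: ennreal_le_iff)
  then have "sqnorm M p (\<lambda>\<omega>. doob (Suc k) \<omega> - doob k \<omega>) \<le> (c powr p * A) powr (2 / p)"
    unfolding sqnorm_def using p by (intro powr_mono2) (auto intro!: integral_nonneg_AE)
  also have "\<dots> = c\<^sup>2 * A powr (2 / p)"
    using p c A by (simp add: powr_mult powr_powr)
  finally show "sqnorm M p (\<lambda>\<omega>. doob (Suc k) \<omega> - doob k \<omega>)
      \<le> (acoef a (n - Suc k))\<^sup>2 * A powr (2 / p)"
    by (simp add: c_def)
qed

text \<open>The induction starts at \<open>1\<close>: the first increment starts from a constant and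
  enters with factor \<open>1\<close>, and each later one costs a factor \<open>p - 1\<close>
  through Rio's inequality. Integrability and centring are carried along to identify the mean at the
  end.\<close>

lemma doob_deviation:
  assumes p: "p \<ge> 2" and A: "\<And>k. k \<in> {1..n} \<Longrightarrow> A k \<ge> 0"
    and moment: "\<And>k. k < n \<Longrightarrow>
      (\<integral>\<^sup>+ \<omega>. epowr (H F (P (Suc k)) (Suc k) (history F \<xi> k (\<lambda>i. \<epsilon> i \<omega>)) (\<epsilon> (Suc k) \<omega>)) p \<partial>M)
        \<le> ennreal (A (Suc k))"
    and k: "1 \<le> k" "k \<le> n"
  shows "integrable M (\<lambda>\<omega>. \<bar>doob k \<omega> - doob 0 \<omega>\<bar> powr p) \<and>
    integrable M (doob k) \<and> (\<integral>\<omega>. doob k \<omega> - doob 0 \<omega> \<partial>M) = 0 \<and>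
    sqnorm M p (\<lambda>\<omega>. doob k \<omega> - doob 0 \<omega>) \<le> (acoef a (n - 1))\<^sup>2 * A 1 powr (2 / p)
      + (p - 1) * (\<Sum>i = 2..k. (acoef a (n - i))\<^sup>2 * A i powr (2 / p))"
  using k
proof (induction k rule: dec_induct)
  note [measurable] = measurable_doob
  have int_p: "integrable M (\<lambda>\<omega>. \<bar>doob (Suc k) \<omega> - doob k \<omega>\<bar> powr p)"
    and sq: "sqnorm M p (\<lambda>\<omega>. doob (Suc k) \<omega> - doob k \<omega>)
      \<le> (acoef a (n - Suc k))\<^sup>2 * A (Suc k) powr (2 / p)" if "k < n" for k
    using doob_increment_moment[OF that _ _ moment[OF that]] A[of "Suc k"] p that by auto
  have int: "integrable M (\<lambda>\<omega>. doob (Suc k) \<omega> - doob k \<omega>)" if "k < n" for k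
  proof (rule Bochner_Integration.integrable_bound)
    show "integrable M (\<lambda>\<omega>. 1 + \<bar>doob (Suc k) \<omega> - doob k \<omega>\<bar> powr p)"
      using int_p[OF that] by simp
    have "\<bar>d\<bar> \<le> 1 + \<bar>d\<bar> powr p" for d :: real
    proof (cases "\<bar>d\<bar> \<le> 1")
      case True
      then show ?thesis using powr_ge_zero[of "\<bar>d\<bar>" p] by linarith
    next
      case False
      then have "\<bar>d\<bar> powr 1 \<le> \<bar>d\<bar> powr p" using p by (intro powr_mono) auto
      then show ?thesis by simp
    qed
    then show "AE \<omega> in M. norm (doob (Suc k) \<omega> - doob k \<omega>)
        \<le> norm (1 + \<bar>doob (Suc k) \<omega> - doob k \<omega>\<bar> powr p)"
      by simp
  qed simp
  have zero: "(\<integral>\<omega>. doob (Suc k) \<omega> - doob k \<omega> \<partial>M) = 0" if "k < n" for k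
    using integral_doob_increment[OF that, of "\<lambda>_. 1"] int[OF that] by simp
  define c where "c = doob 0 undefined"
  have c: "doob 0 \<omega> = c" for \<omega> unfolding c_def by (rule doob_0)
  {
    case base
    have "integrable M (\<lambda>\<omega>. doob 1 \<omega> - c + c)"
      using int[of 0] base unfolding c by (intro Bochner_Integration.integrable_add) auto
    then show ?case
      using int_p[of 0] sq[of 0] zero[of 0] base unfolding c by simp
  next
    case (step k)
    then have k: "k < n" "1 \<le> k" by auto
    then have IH: "integrable M (\<lambda>\<omega>. \<bar>doob k \<omega> - c\<bar> powr p)" "integrable M (doob k)"
      "(\<integral>\<omega>. doob k \<omega> - c \<partial>M) = 0"
      "sqnorm M p (\<lambda>\<omega>. doob k \<omega> - c) \<le> (acoef a (n - 1))\<^sup>2 * A 1 powr (2 / p)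
        + (p - 1) * (\<Sum>i = 2..k. (acoef a (n - i))\<^sup>2 * A i powr (2 / p))"
      using step.IH unfolding c by auto
    have eq: "doob (Suc k) \<omega> - c = (doob k \<omega> - c) + (doob (Suc k) \<omega> - doob k \<omega>)" for \<omega>
      by simp
    have i1: "integrable M (\<lambda>\<omega>. \<bar>doob (Suc k) \<omega> - c\<bar> powr p)"
      unfolding eq using IH int_p[OF k(1)] p by (intro integrable_powr_add_abs) auto
    have i2: "integrable M (doob (Suc k))"
      using Bochner_Integration.integrable_add[OF int[OF k(1)] IH(2)] by simp
    have i3: "(\<integral>\<omega>. doob (Suc k) \<omega> - c \<partial>M) = 0"
      unfolding eq using IH int[OF k(1)] zero[OF k(1)]
      by (subst Bochner_Integration.integral_add) auto
    \<comment> \<open>The weight is a function of \<open>doob k\<close> alone, because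
      \<open>c\<close> is a constant.\<close>
    have orth: "(\<integral>\<omega>. sgn (doob k \<omega> - c) * \<bar>doob k \<omega> - c\<bar> powr (p - 1)
        * (doob (Suc k) \<omega> - doob k \<omega>) \<partial>M) = 0"
    proof (rule integral_doob_increment[OF k(1), of "\<lambda>z. sgn (z - c) * \<bar>z - c\<bar> powr (p - 1)"])
      show "integrable M (\<lambda>\<omega>. sgn (doob k \<omega> - c) * \<bar>doob k \<omega> - c\<bar> powr (p - 1)
          * (doob (Suc k) \<omega> - doob k \<omega>))"
        using IH int_p[OF k(1)] p by (intro integrable_powr_sgn_mult) auto
    qed measurable
    have "sqnorm M p (\<lambda>\<omega>. doob (Suc k) \<omega> - c)
        \<le> sqnorm M p (\<lambda>\<omega>. doob k \<omega> - c) + (p - 1) * sqnorm M p (\<lambda>\<omega>. doob (Suc k) \<omega> - doob k \<omega>)"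
      unfolding eq using IH int_p[OF k(1)] p orth
      by (intro sqnorm_add_le_orthogonal) auto
    also have "\<dots> \<le> ((acoef a (n - 1))\<^sup>2 * A 1 powr (2 / p)
        + (p - 1) * (\<Sum>i = 2..k. (acoef a (n - i))\<^sup>2 * A i powr (2 / p)))
        + (p - 1) * ((acoef a (n - Suc k))\<^sup>2 * A (Suc k) powr (2 / p))"
      using IH(4) sq[OF k(1)] p by (intro add_mono mult_left_mono) auto
    also have "\<dots> = (acoef a (n - 1))\<^sup>2 * A 1 powr (2 / p)
        + (p - 1) * (\<Sum>i = 2..Suc k. (acoef a (n - i))\<^sup>2 * A i powr (2 / p))"
      using k by (simp add: algebra_simps)
    finally show ?case using i1 i2 i3 unfolding c by simp
  }
qed

end

text \<open>The Lipschitz hypothesis forces \<open>f\<close>, defined on whole sequences, to depend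
  on the entries \<open>1\<close> to \<open>n\<close> only. Nonnegativity of \<open>A k\<close>
  keeps \<open>ennreal (A k)\<close> faithful, as negative reals are truncated to zero.\<close>

theorem proposition5p1:
  fixes M :: "'w measure"
    and \<epsilon> :: "nat \<Rightarrow> 'w \<Rightarrow> 'y::polish_space"
    and F :: "nat \<Rightarrow> (nat \<Rightarrow> 'x::polish_space) \<Rightarrow> 'y \<Rightarrow> 'x"
    and \<xi> :: "int \<Rightarrow> 'x"
    and X :: "int \<Rightarrow> 'w \<Rightarrow> 'x"
    and a :: "nat \<Rightarrow> real"
    and n :: nat
    and f :: "(nat \<Rightarrow> 'x) \<Rightarrow> real"
    and p :: real
    and A :: "nat \<Rightarrow> real"
  assumes "prob_space M"
    and "prob_space.indep_vars M (\<lambda>_. borel) \<epsilon> {1..}"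
    and "\<And>m. m \<ge> 1 \<Longrightarrow>
      (\<lambda>(x, y). F m x y) \<in> (\<Pi>\<^sub>M i\<in>UNIV. borel) \<Otimes>\<^sub>M borel \<rightarrow>\<^sub>M borel"
    and "\<And>i \<omega>. i \<le> 0 \<Longrightarrow> \<omega> \<in> space M \<Longrightarrow> X i \<omega> = \<xi> i"
    and "\<And>m \<omega>. m \<ge> 1 \<Longrightarrow> \<omega> \<in> space M \<Longrightarrow> X (int m) \<omega> = F m (past X m \<omega>) (\<epsilon> m \<omega>)"
    and "\<And>i. i \<ge> 1 \<Longrightarrow> a i \<ge> 0"
    and "summable (\<lambda>j. a (Suc j))"
    and "(\<Sum>j. a (Suc j)) < 1"
    and "\<And>m x x'. m \<ge> 1 \<Longrightarrow>
      (\<integral>\<^sup>+ \<omega>. ennreal (dist (F m x (\<epsilon> m \<omega>)) (F m x' (\<epsilon> m \<omega>))) \<partial>M)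
        \<le> (\<Sum>j. ennreal (a (Suc j) * dist (x j) (x' j)))"
    and "n \<ge> 1"
    and "\<And>x x'. \<bar>f x - f x'\<bar> \<le> (\<Sum>i = 1..n. dist (x i) (x' i))"
    and "p \<ge> 2"
    and "\<And>k. k \<in> {1..n} \<Longrightarrow> A k \<ge> 0"
    and "\<And>k. k \<in> {1..n} \<Longrightarrow>
      (\<integral>\<^sup>+ \<omega>. epowr (H F (distr M borel (\<epsilon> k)) k (past X k \<omega>) (\<epsilon> k \<omega>)) p \<partial>M) \<le> ennreal (A k)"
  shows "Lp_norm M p (\<lambda>\<omega>. f (\<lambda>i. X (int i) \<omega>) - (\<integral>\<omega>'. f (\<lambda>i. X (int i) \<omega>') \<partial>M))
    \<le> ennreal (sqrt (Abound a A n p))"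
proof -
  note p = \<open>p \<ge> 2\<close> and A_nonneg = assms(13) and H_moment = assms(14)
  interpret prob_space M by fact
  define P where "P = (\<lambda>k. distr M borel (\<epsilon> k))"
  have meas_\<epsilon>: "\<epsilon> m \<in> borel_measurable M" if "m \<ge> 1" for m
    using that assms(2) by (auto simp: indep_vars_def)
  have past: "past X (Suc k) \<omega> = history F \<xi> k (\<lambda>i. \<epsilon> i \<omega>)" if "\<omega> \<in> space M" for k \<omega>
    using assms(4,5) that by (intro past_eq_history) auto
  have moment: "(\<integral>\<^sup>+ \<omega>. epowr (H F (P (Suc k)) (Suc k) (history F \<xi> k (\<lambda>i. \<epsilon> i \<omega>)) (\<epsilon> (Suc k) \<omega>)) p \<partial>M)
      \<le> ennreal (A (Suc k))" if "k < n" for k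
  proof -
    have "(\<integral>\<^sup>+ \<omega>. epowr (H F (P (Suc k)) (Suc k) (history F \<xi> k (\<lambda>i. \<epsilon> i \<omega>)) (\<epsilon> (Suc k) \<omega>)) p \<partial>M)
        = (\<integral>\<^sup>+ \<omega>. epowr (H F (P (Suc k)) (Suc k) (past X (Suc k) \<omega>) (\<epsilon> (Suc k) \<omega>)) p \<partial>M)"
      by (intro nn_integral_cong) (simp add: past)
    then show ?thesis
      using H_moment[of "Suc k"] that by (simp add: P_def)
  qed
  \<comment> \<open>If \<open>H\<close> were infinite on all these histories, its moment would be
    the integral of infinity over a probability space, contradicting the finite bound.\<close>
  have H_somewhere: "\<exists>h\<in>histories \<xi> k. \<exists>e. H F (P (Suc k)) (Suc k) h e < \<infinity>" if "k < n" for k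
  proof (rule ccontr)
    assume "\<not> ?thesis"
    then have "H F (P (Suc k)) (Suc k) (history F \<xi> k (\<lambda>i. \<epsilon> i \<omega>)) (\<epsilon> (Suc k) \<omega>) = \<top>" for \<omega>
      using history_in_histories[of F \<xi> k "\<lambda>i. \<epsilon> i \<omega>"] by (metis infinity_ennreal_def less_top)
    then show False
      using moment[OF that] by (simp add: epowr_def emeasure_space_1 top_unique)
  qed
  interpret driven_recursion F P \<xi> a n f M \<epsilon>
  proof (intro driven_recursion.intro contractive_recursion.intro driven_recursion_axioms.intro)
    fix m :: nat and x x' assume m: "m \<ge> 1"
    note [measurable] = meas_\<epsilon>[OF m]
    show "prob_space (P m)" unfolding P_def by (rule prob_space_distr) simp
    have [measurable]: "F m g \<in> borel_measurable borel" for g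
      using measurable_compose[OF measurable_Pair[OF measurable_const measurable_ident] assms(3)[OF m], of g]
      by (simp add: space_PiM)
    show "(\<integral>\<^sup>+ y. ennreal (dist (F m x y) (F m x' y)) \<partial>P m)
        \<le> (\<Sum>j. ennreal (a (Suc j) * dist (x j) (x' j)))"
      using assms(9)[OF m, of x x'] by (simp add: P_def nn_integral_distr)
  qed (fact | simp add: P_def)+
  \<comment> \<open>The two sequences need not agree beyond index \<open>n\<close>, where truncated
    subtraction always returns the entry at time \<open>n\<close>. Equality of the values of
    \<open>f\<close> comes from its Lipschitz bound being zero.\<close>
  have f_doob: "f (\<lambda>i. X (int i) \<omega>) = doob n \<omega>" if "\<omega> \<in> space M" for \<omega>
  proof -
    have "X (int i) \<omega> = history F \<xi> n (\<lambda>i. \<epsilon> i \<omega>) (n - i)" if "i \<in> {1..n}" for i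
      using that by (simp add: past[OF \<open>\<omega> \<in> space M\<close>, symmetric] past_def)
    then have "(\<Sum>i = 1..n. dist (X (int i) \<omega>) (history F \<xi> n (\<lambda>i. \<epsilon> i \<omega>) (n - i))) = 0"
      by (intro sum.neutral) simp
    then show ?thesis
      using assms(11)[of "\<lambda>i. X (int i) \<omega>" "\<lambda>i. history F \<xi> n (\<lambda>i. \<epsilon> i \<omega>) (n - i)"]
      by (simp add: doob_def)
  qed
  note dev = doob_deviation[OF p A_nonneg moment \<open>n \<ge> 1\<close> order_refl]
  have int_p: "integrable M (\<lambda>\<omega>. \<bar>doob n \<omega> - doob 0 \<omega>\<bar> powr p)"
    and int: "integrable M (doob n)" and zero: "(\<integral>\<omega>. doob n \<omega> - doob 0 \<omega> \<partial>M) = 0"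
    and sq: "sqnorm M p (\<lambda>\<omega>. doob n \<omega> - doob 0 \<omega>) \<le> Abound a A n p"
    using dev by (auto simp: Abound_def)
  define c where "c = doob 0 undefined"
  have c: "doob 0 \<omega> = c" for \<omega> unfolding c_def by (rule doob_0)
  have mean: "(\<integral>\<omega>. f (\<lambda>i. X (int i) \<omega>) \<partial>M) = c"
  proof -
    have "(\<integral>\<omega>. f (\<lambda>i. X (int i) \<omega>) \<partial>M) = (\<integral>\<omega>. doob n \<omega> \<partial>M)"
      by (intro Bochner_Integration.integral_cong) (simp_all add: f_doob)
    also have "\<dots> = c"
      using zero int unfolding c by (simp add: prob_space)
    finally show ?thesis .
  qed
  define I where "I = (\<integral>\<omega>. \<bar>doob n \<omega> - c\<bar> powr p \<partial>M)"
  have I: "I \<ge> 0" unfolding I_def by (intro integral_nonneg_AE) auto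
  have "(\<integral>\<^sup>+ \<omega>. ennreal (\<bar>f (\<lambda>i. X (int i) \<omega>) - c\<bar> powr p) \<partial>M) = (\<integral>\<^sup>+ \<omega>. ennreal (\<bar>doob n \<omega> - c\<bar> powr p) \<partial>M)"
    by (intro nn_integral_cong) (simp add: f_doob)
  also have "\<dots> = ennreal I"
    unfolding I_def using int_p unfolding c by (intro nn_integral_eq_integral) auto
  finally have "Lp_norm M p (\<lambda>\<omega>. f (\<lambda>i. X (int i) \<omega>) - c) = ennreal (I powr (1 / p))"
    using I by (simp add: Lp_norm_def epowr_def)
  also have "I powr (1 / p) \<le> sqrt (Abound a A n p)"
  proof (rule real_le_rsqrt)
    have "(I powr (1 / p))\<^sup>2 = sqnorm M p (\<lambda>\<omega>. doob n \<omega> - doob 0 \<omega>)"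
      unfolding sqnorm_def c I_def[symmetric] by (simp add: power2_eq_square flip: powr_add)
    then show "(I powr (1 / p))\<^sup>2 \<le> Abound a A n p"
      using sq by simp
  qed
  finally show ?thesis
    by (simp add: mean ennreal_leI)
qed

end
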